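(* Fix a finite baseline premise base $B_0$ and its noisy version $\tilde B_0=(B_0\setminus B_0^-)\cup B_0^+$. Let $q\in\mathrm{Cn}(\tilde B_0)\cap\mathrm{Cn}(B_0)$, let $\rho>0$ be the storage-to-computation cost ratio and $f_q\ge1$ the access frequency. Let $\tilde m:=|\tilde B_0|$ and $\tilde n:=\mathrm{Dd}(q\mid\tilde B_0)$. Assume $(q,\tilde B_0)$ lies in the information-rich regime and is generic/incompressible, so that the depth–information theorem applies to $(q,\tilde B_0)$; i.e. $\tilde n\ge1$, $\log\tilde m\le\tilde n\le\mathrm{poly}(\tilde m)$, serializability holds, $\mathcal P$ satisfies the richness condition with parameter $\delta_0>0$, and with $n':=N(q\mid\tilde B_0)$, $K(q\mid\langle\tilde B_0\rangle)\ge(1-\delta)n'\log(\tilde m+n')$ for some $\delta>\delta_0$. Put $\tilde\ell_q:=K(q\mid\langle\tilde B_0\rangle)+O(1)$, $$\widetilde{\mathrm{Cost}}_{\mathrm{cache}}(q;\tilde B_0):=\frac{\rho\tilde\ell_q}{f_q}+\frac{\mathrm{Dd}(q\mid\tilde B_0)}{f_q}+c_{\mathrm{hit}},\qquad\widetilde{\mathrm{Cost}}_{\mathrm{derive}}(q;\tilde B_0):=\mathrm{Dd}(q\mid\tilde B_0),$$ with $c_{\mathrm{hit}}=O(1)$, and let $\widetilde{\mathrm{Cost}}^*(q;\tilde B_0)$ be the minimum of these two. Then: (i) $$\widetilde{\mathrm{Cost}}^*(q;\tilde B_0)=\min\left\{\frac{\rho\tilde\ell_q}{f_q}+O\!\left(\frac{\tilde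 n}{f_q}\right)+O(1),\ \Theta\!\left(\frac{\tilde\ell_q}{\log(\tilde m+\tilde n)}\right)\right\}.$$ (ii) The noisy critical frequency (at which the two strategies have equal asymptotic cost) is $\tilde f_c=\Theta(\rho\log(\tilde m+\tilde n))$. (iii) Under the bounded and effectively describable noise assumption, $$\widetilde{\mathrm{Cost}}^*(q;\tilde B_0)\le\mathrm{Cost}^*(q;B_0)+O\!\left(\frac{\rho\,\mathcal N\log(m+\mathcal N)}{f_q}\right)+O(d_{\mathrm{rec}}),$$ where $m:=|B_0|$, $\mathcal N:=|B_0^-|+|B_0^+|$, $\mathrm{Cost}^*(q;B_0)$ is the ideal optimal amortized cost under $B_0$, and $d_{\mathrm{rec}}$ is the reconstruction depth of lost premises.
   Context: $\log=\log_2$; $\mathrm{poly}$ denotes a fixed polynomial bound; constants do not depend on the particular instance. $\mathcal P$ is a fixed effective proof system (decidable proof checking, finite rule set of bounded arity) for $\mathcal L$ = many-sorted FO(LFP); $\mathrm{Cn}(\Gamma)$ is the set of formulas derivable from the finite set $\Gamma$. $\mathbb S_O$ is an ambient set of formulas with finite binary encodings, decidable equality and effectively evaluable predicates. A premise base is a finite effectively listable $B\subseteq\mathbb S_O$ with decidable membership and canonical computable encoding $\langle B\rangle$. Depth: $P_O$ assigns to each $s\in\mathbb S_O$ a finite set $P_O(s)\subseteq\mathbb S_O$ computable from its encoding, with no infinite backward chain; for $s\in\mathbb S_O\setminus B$, $P_O(s)$ is exactly the set of immediate premises in a fixed normal-form single-step inference of $\mathcal P$ concluding $s$. $\mathrm{Dd}(s\mid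 B)=0$ if $s\in B$, else $1+\max_{s'\in P_O(s)}\mathrm{Dd}(s'\mid B)$ (with $\max\varnothing=0$). Traces: a derivation trace of $q$ from $B$ is $\pi=((r_1,\vec p_1),\dots,(r_\ell,\vec p_\ell);o)$ with $r_i$ rule identifiers, $\vec p_i$ vectors of indices, $o$ an index, such that the following replay outputs $q$: $P_0$ is the list of elements of $B$ in canonical order; at step $i$ rule $r_i$ is applied to the formulas of the pool $P_{i-1}$ indexed by $\vec p_i$, and its conclusion is appended to give $P_i$; the output is the formula at index $o$ of $P_\ell$. Each rule application must be correct. Length $|\pi|=\ell$; $N(q\mid B)$ is the minimum length of a trace deriving $q$ from $B$. $K(\cdot\mid\cdot)$ is prefix-free conditional Kolmogorov complexity. Serializability: there are constants $c_{\min},c_{\max}>0$ such that for all $(q,B)$ in the class considered with $q\in\mathrm{Cn}(B)$ and $\mathrm{Dd}(q\mid B)<\infty$, $c_{\min}\mathrm{Dd}(q\mid B)\le N(q\mid B)\le c_{\max}\mathrm{Dd}(q\mid B)$. Information-rich regime: $K(q\mid\langle B\rangle)=\omega(\log|B|)$ along the family as $|B|\to\infty$. Richness with parameter $\delta_0$: there is $m_0$ such that for all $m\ge m_0$, all integers $n$ with $\log m\le n\le\mathrm{poly}(m)$ and all premise bases $B$ with $|B|=m$, $|\{\langle q\rangle:N(q\mid B)=n\}|\ge2^{(1-\delta_0)n\log(m+n)}$. Noisy base: $B_0^-\subseteq B_0$ and $B_0^+\subseteq\mathbb S_O\setminus B_0$ are finite. Bounded and effectively describable noise: (a) there is a computable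 family $\{\mathcal V_s\}_{s\in\mathbb N}$, $\mathcal V_s\subseteq\mathbb S_O$, with canonical indexing, $|\mathcal V_s|\le\mathrm{poly}(s)$, $B_0\cup B_0^+\subseteq\mathcal V_{m+\mathcal N}$; (b) given either $\langle B_0\rangle$ or $\langle\tilde B_0\rangle$, $B_0^-$ and $B_0^+$ are effectively describable (with decidable membership) by index lists over $\mathcal V_{m+\mathcal N}$ of total length $O(\mathcal N\log(m+\mathcal N))$. Reconstruction depth: with $B_\cap:=B_0\setminus B_0^-$, $d_{\mathrm{rec}}:=\max_{b\in B_0^-}\mathrm{Dd}(b\mid B_\cap)$, with $d_{\mathrm{rec}}=\infty$ if some $b\in B_0^-$ is not in $\mathrm{Cn}(B_\cap)$. Ideal costs: $\mathrm{Cost}^*(q;B_0)=\min\left\{\frac{\rho\,\ell_q(B_0)}{f_q}+\frac{\mathrm{Dd}(q\mid B_0)}{f_q}+c_{\mathrm{hit}},\ \mathrm{Dd}(q\mid B_0)\right\}$, where $\ell_q(B_0)$ is a prefix-free code length with $K(q\mid\langle B_0\rangle)\le\ell_q(B_0)\le K(q\mid\langle B_0\rangle)+O(1)$. *)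

theory Defs
  imports
    "HOL-Library.Nat_Bijection"
    "HOL-Library.Sublist"
    "HOL-Library.Extended_Real"
    "HOL-Library.Landau_Symbols"
    "HOL-Computational_Algebra.Polynomial"
begin

section \<open>Partial recursive functions\<close>

definition mu :: "(nat \<Rightarrow> nat option) \<Rightarrow> nat option" where
  "mu h = (if \<exists>k. h k = Some 0 \<and> (\<forall>j<k. \<exists>v>0. h j = Some v)
           then Some (LEAST k. h k = Some 0) else None)"

(* Unary partial recursive functions; several arguments are passed through Cantor pairing, so
   projections and pairing replace the usual arity bookkeeping.  None means divergence. *)
inductive partrec :: "(nat \<Rightarrow> nat option) \<Rightarrow> bool" where
  zero: "partrec (\<lambda>n. Some 0)"
| succ: "partrec (\<lambda>n. Some (Suc n))"
| left: "partrec (\<lambda>n. Some (fst (prod_decode n)))"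
| right: "partrec (\<lambda>n. Some (snd (prod_decode n)))"
| pair: "partrec f \<Longrightarrow> partrec g \<Longrightarrow>
    partrec (\<lambda>n. Option.bind (f n) (\<lambda>a. Option.bind (g n) (\<lambda>b. Some (prod_encode (a, b)))))"
| comp: "partrec f \<Longrightarrow> partrec g \<Longrightarrow> partrec (\<lambda>n. Option.bind (g n) f)"
| prec: "partrec f \<Longrightarrow> partrec g \<Longrightarrow>
    partrec (\<lambda>n. case prod_decode n of (a, k) \<Rightarrow>
      rec_nat (f a) (\<lambda>y r. Option.bind r (\<lambda>v. g (prod_encode (a, prod_encode (y, v))))) k)"
| minim: "partrec f \<Longrightarrow> partrec (\<lambda>n. mu (\<lambda>k. f (prod_encode (n, k))))"

definition computable :: "(nat \<Rightarrow> nat) \<Rightarrow> bool" where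
  "computable f \<longleftrightarrow> partrec (\<lambda>n. Some (f n))"

definition decidable :: "nat set \<Rightarrow> bool" where
  "decidable A \<longleftrightarrow> computable (\<lambda>n. if n \<in> A then 1 else 0)"


section \<open>Prefix-free conditional Kolmogorov complexity\<close>

(* Bijective base-2 numeration: the standard identification of binary strings with naturals. *)
fun nat_of_string :: "bool list \<Rightarrow> nat" where
  "nat_of_string [] = 0"
| "nat_of_string (b # bs) = 2 * nat_of_string bs + (if b then 2 else 1)"

definition string_of_nat :: "nat \<Rightarrow> bool list" where
  "string_of_nat = inv nat_of_string"

(* M p y is the output of program p on the conditioning datum y.  Outputs and conditions are
   naturals (equivalently strings, by the identification above). *)
definition prefix_machine :: "(bool list \<Rightarrow> nat \<Rightarrow> nat option) \<Rightarrow> bool" where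
  "prefix_machine M \<longleftrightarrow>
     (\<exists>g. partrec g \<and> (\<forall>p y. g (prod_encode (nat_of_string p, y)) = M p y)) \<and>
     (\<forall>y p p'. M p y \<noteq> None \<and> M p' y \<noteq> None \<and> prefix p p' \<longrightarrow> p = p')"

definition universal_prefix_machine :: "(bool list \<Rightarrow> nat \<Rightarrow> nat option) \<Rightarrow> bool" where
  "universal_prefix_machine U \<longleftrightarrow> prefix_machine U \<and>
     (\<forall>M. prefix_machine M \<longrightarrow>
        (\<exists>c. \<forall>p x y. M p y = Some x \<longrightarrow> (\<exists>p'. U p' y = Some x \<and> length p' \<le> length p + c)))"

definition Kolm :: "(bool list \<Rightarrow> nat \<Rightarrow> nat option) \<Rightarrow> nat \<Rightarrow> nat \<Rightarrow> nat" where
  "Kolm U x y = (LEAST n. \<exists>p. length p = n \<and> U p y = Some x)"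


section \<open>Many-sorted first-order logic with least fixed points\<close>

(* Sorts, symbols and variable names are naturals; None marks a symbol outside the signature. *)
record signature =
  fun_type :: "nat \<Rightarrow> (nat list \<times> nat) option"
  rel_type :: "nat \<Rightarrow> nat list option"

(* Var x s is the variable named x of sort s. *)
datatype trm = Var nat nat | App nat "trm list"

(* RelVar X ss ts applies the relation variable X of type ss.
   LFP X xs phi ts is [lfp X xs. phi](ts), where xs lists (name, sort) pairs and the bound
   relation variable X has type map snd xs. *)
datatype fml =
    Equal trm trm
  | Pred nat "trm list"
  | RelVar nat "nat list" "trm list"
  | Neg fml
  | Conj fml fml
  | Exists nat nat fml
  | LFP nat "(nat \<times> nat) list" fml "trm list"

fun sort_of :: "signature \<Rightarrow> trm \<Rightarrow> nat option" where
  "sort_of \<Sigma> (Var x s) = Some s"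
| "sort_of \<Sigma> (App f ts) =
     (case fun_type \<Sigma> f of
        None \<Rightarrow> None
      | Some (ss, s) \<Rightarrow> if map (sort_of \<Sigma>) ts = map Some ss then Some s else None)"

(* polarity b X phi: every free occurrence of the relation variable X in phi is positive if b,
   negative otherwise. *)
fun polarity :: "bool \<Rightarrow> nat \<times> nat list \<Rightarrow> fml \<Rightarrow> bool" where
  "polarity b X (Equal t u) = True"
| "polarity b X (Pred R ts) = True"
| "polarity b X (RelVar Y ss ts) = (b \<or> X \<noteq> (Y, ss))"
| "polarity b X (Neg \<phi>) = polarity (\<not> b) X \<phi>"
| "polarity b X (Conj \<phi> \<psi>) = (polarity b X \<phi> \<and> polarity b X \<psi>)"
| "polarity b X (Exists x s \<phi>) = polarity b X \<phi>"
| "polarity b X (LFP Y xs \<phi> ts) = (X = (Y, map snd xs) \<or> polarity b X \<phi>)"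

fun wff :: "signature \<Rightarrow> fml \<Rightarrow> bool" where
  "wff \<Sigma> (Equal t u) = (sort_of \<Sigma> t \<noteq> None \<and> sort_of \<Sigma> t = sort_of \<Sigma> u)"
| "wff \<Sigma> (Pred R ts) = (\<exists>ss. rel_type \<Sigma> R = Some ss \<and> map (sort_of \<Sigma>) ts = map Some ss)"
| "wff \<Sigma> (RelVar X ss ts) = (map (sort_of \<Sigma>) ts = map Some ss)"
| "wff \<Sigma> (Neg \<phi>) = wff \<Sigma> \<phi>"
| "wff \<Sigma> (Conj \<phi> \<psi>) = (wff \<Sigma> \<phi> \<and> wff \<Sigma> \<psi>)"
| "wff \<Sigma> (Exists x s \<phi>) = wff \<Sigma> \<phi>"
| "wff \<Sigma> (LFP X xs \<phi> ts) =
     (distinct xs \<and> wff \<Sigma> \<phi> \<and> polarity True (X, map snd xs) \<phi> \<and>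
      map (sort_of \<Sigma>) ts = map (Some \<circ> snd) xs)"


section \<open>Effective proof systems\<close>

(* infer r ps is the conclusion of rule r applied to the premises ps, None if r does not apply. *)
record calculus =
  sig :: signature
  encode :: "fml \<Rightarrow> bool list"
  rules :: "nat set"
  infer :: "nat \<Rightarrow> fml list \<Rightarrow> fml option"

definition lang :: "calculus \<Rightarrow> fml set" where
  "lang \<P> = {\<phi>. wff (sig \<P>) \<phi>}"

definition code :: "calculus \<Rightarrow> fml \<Rightarrow> nat" where
  "code \<P> \<phi> = nat_of_string (encode \<P> \<phi>)"

definition effective_calculus :: "calculus \<Rightarrow> bool" where
  "effective_calculus \<P> \<longleftrightarrow>
     inj_on (encode \<P>) (lang \<P>) \<and>
     decidable (code \<P> ` lang \<P>) \<and>
     finite (rules \<P>) \<and>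
     (\<exists>a. \<forall>r\<in>rules \<P>. \<forall>ps. infer \<P> r ps \<noteq> None \<longrightarrow> length ps \<le> a) \<and>
     (\<forall>r\<in>rules \<P>. \<forall>ps c. infer \<P> r ps = Some c \<longrightarrow> set ps \<subseteq> lang \<P> \<and> c \<in> lang \<P>) \<and>
     decidable {prod_encode (r, prod_encode (list_encode (map (code \<P>) ps), code \<P> c)) | r ps c.
                  r \<in> rules \<P> \<and> infer \<P> r ps = Some c}"

inductive_set Cn :: "calculus \<Rightarrow> fml set \<Rightarrow> fml set" for \<P> \<Gamma> where
  premise: "\<phi> \<in> \<Gamma> \<Longrightarrow> \<phi> \<in> Cn \<P> \<Gamma>"
| step: "r \<in> rules \<P> \<Longrightarrow> \<forall>p\<in>set ps. p \<in> Cn \<P> \<Gamma> \<Longrightarrow> infer \<P> r ps = Some c \<Longrightarrow> c \<in> Cn \<P> \<Gamma>"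


section \<open>Premise bases, derivation traces and depth\<close>

(* Listability and decidability of membership are automatic for finite sets. *)
definition premise_base :: "fml set \<Rightarrow> fml set \<Rightarrow> bool" where
  "premise_base S B \<longleftrightarrow> finite B \<and> B \<subseteq> S"

definition base_list :: "calculus \<Rightarrow> fml set \<Rightarrow> fml list" where
  "base_list \<P> B = sorted_key_list_of_set (code \<P>) B"

definition base_code :: "calculus \<Rightarrow> fml set \<Rightarrow> nat" where
  "base_code \<P> B = list_encode (map (code \<P>) (base_list \<P> B))"

fun replay :: "calculus \<Rightarrow> fml list \<Rightarrow> (nat \<times> nat list) list \<Rightarrow> fml list option" where
  "replay \<P> pool [] = Some pool"
| "replay \<P> pool ((r, js) # steps) =
     (if r \<in> rules \<P> \<and> (\<forall>j\<in>set js. j < length pool)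
      then Option.bind (infer \<P> r (map ((!) pool) js)) (\<lambda>c. replay \<P> (pool @ [c]) steps)
      else None)"

definition is_trace :: "calculus \<Rightarrow> fml set \<Rightarrow> fml \<Rightarrow> (nat \<times> nat list) list \<times> nat \<Rightarrow> bool" where
  "is_trace \<P> B q = (\<lambda>(steps, out).
     \<exists>pool. replay \<P> (base_list \<P> B) steps = Some pool \<and> out < length pool \<and> pool ! out = q)"

(* The infimum of the empty set is infinity: no trace. *)
definition Ntr :: "calculus \<Rightarrow> fml set \<Rightarrow> fml \<Rightarrow> enat" where
  "Ntr \<P> B q = Inf {enat (length (fst \<pi>)) | \<pi>. is_trace \<P> B q \<pi>}"

definition Dd :: "fml set \<Rightarrow> (fml \<Rightarrow> fml set) \<Rightarrow> fml set \<Rightarrow> fml \<Rightarrow> nat" where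
  "Dd S PO B = wfrec {(s', s). s \<in> S \<and> s' \<in> PO s}
     (\<lambda>D s. if s \<in> B then 0 else Suc (Max (insert 0 (D ` PO s))))"

definition premise_structure :: "calculus \<Rightarrow> fml set \<Rightarrow> (fml \<Rightarrow> fml set) \<Rightarrow> bool" where
  "premise_structure \<P> S PO \<longleftrightarrow>
     S \<subseteq> lang \<P> \<and> decidable (code \<P> ` S) \<and>
     (\<forall>s\<in>S. finite (PO s) \<and> PO s \<subseteq> S) \<and>
     (\<exists>g. computable g \<and> (\<forall>s\<in>S. g (code \<P> s) = base_code \<P> (PO s))) \<and>
     wf {(s', s). s \<in> S \<and> s' \<in> PO s}"

(* Required only where s is derivable from B: an s outside B and outside Cn B is allowed to have
   no inference at all, otherwise well-foundedness would force S to be contained in Cn B. *)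
definition normal_form_premises ::
    "calculus \<Rightarrow> fml set \<Rightarrow> (fml \<Rightarrow> fml set) \<Rightarrow> fml set \<Rightarrow> bool" where
  "normal_form_premises \<P> S PO B \<longleftrightarrow>
     (\<forall>s\<in>(S \<inter> Cn \<P> B) - B. \<exists>r\<in>rules \<P>. \<exists>ps. set ps = PO s \<and> infer \<P> r ps = Some s)"


section \<open>Standing conditions\<close>

(* Depths are natural numbers because premise sets are finite and PO is well-founded. *)
definition serializable ::
    "calculus \<Rightarrow> fml set \<Rightarrow> (fml \<Rightarrow> fml set) \<Rightarrow> (fml \<times> fml set) set \<Rightarrow> bool" where
  "serializable \<P> S PO \<C> \<longleftrightarrow>
     (\<exists>cmin>0. \<exists>cmax>0. \<forall>(q, B)\<in>\<C>. q \<in> Cn \<P> B \<longrightarrow>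
        ereal (cmin * real (Dd S PO B q)) \<le> ereal_of_enat (Ntr \<P> B q) \<and>
        ereal_of_enat (Ntr \<P> B q) \<le> ereal (cmax * real (Dd S PO B q)))"

definition rich :: "calculus \<Rightarrow> fml set \<Rightarrow> nat poly \<Rightarrow> real \<Rightarrow> bool" where
  "rich \<P> S pb \<delta>\<^sub>0 \<longleftrightarrow>
     (\<exists>m0. \<forall>m\<ge>m0. \<forall>n B. log 2 (real m) \<le> real n \<and> n \<le> poly pb m \<and> premise_base S B \<and> card B = m \<longrightarrow>
        2 powr ((1 - \<delta>\<^sub>0) * real n * log 2 (real (m + n)))
          \<le> real (card (encode \<P> ` {q. Ntr \<P> B q = enat n})))"

definition code_length ::
    "(bool list \<Rightarrow> nat \<Rightarrow> nat option) \<Rightarrow> calculus \<Rightarrow> fml set \<Rightarrow> (fml \<Rightarrow> fml set \<Rightarrow> nat) \<Rightarrow> bool" where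
  "code_length U \<P> S \<l> \<longleftrightarrow>
     (\<forall>B. premise_base S B \<longrightarrow>
        (\<exists>e :: fml \<Rightarrow> bool list. (\<forall>q\<in>S. length (e q) = \<l> q B) \<and> (\<forall>q\<in>S. \<forall>q'\<in>S. prefix (e q) (e q') \<longrightarrow> q = q'))) \<and>
     (\<exists>c. \<forall>q\<in>S. \<forall>B. premise_base S B \<longrightarrow>
        Kolm U (code \<P> q) (base_code \<P> B) \<le> \<l> q B \<and>
        \<l> q B \<le> Kolm U (code \<P> q) (base_code \<P> B) + c)"


section \<open>Noise\<close>

definition noisy_base :: "fml set \<Rightarrow> fml set \<Rightarrow> fml set \<Rightarrow> fml set" where
  "noisy_base B Bm Bp = (B - Bm) \<union> Bp"

definition rec_depth ::
    "calculus \<Rightarrow> fml set \<Rightarrow> (fml \<Rightarrow> fml set) \<Rightarrow> fml set \<Rightarrow> fml set \<Rightarrow> enat" where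
  "rec_depth \<P> S PO B Bm =
     (if Bm \<subseteq> Cn \<P> (B - Bm) then enat (Max (insert 0 (Dd S PO (B - Bm) ` Bm))) else \<infinity>)"

(* V s lists the vocabulary of parameter s, an element's index being its list position.  The
   bit length of an index list is the sum of the lengths of its binary-coded entries.  D0 and D1
   decode a pair of index lists in the presence of the clean and of the noisy base; V, the
   decoders and the constant c serve the whole family. *)
definition describable_noise ::
    "calculus \<Rightarrow> fml set \<Rightarrow> nat poly \<Rightarrow> ('i \<Rightarrow> fml set) \<Rightarrow> ('i \<Rightarrow> fml set) \<Rightarrow> ('i \<Rightarrow> fml set) \<Rightarrow> bool" where
  "describable_noise \<P> S pb B0 Bm Bp \<longleftrightarrow>
     (\<exists>V :: nat \<Rightarrow> fml list.
        computable (\<lambda>s. list_encode (map (code \<P>) (V s))) \<and>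
        (\<forall>s. distinct (V s) \<and> set (V s) \<subseteq> S \<and> length (V s) \<le> poly pb s) \<and>
        (\<forall>i. B0 i \<union> Bp i \<subseteq> set (V (card (B0 i) + (card (Bm i) + card (Bp i))))) \<and>
        (\<exists>(c :: real) D0 D1. partrec D0 \<and> partrec D1 \<and>
           (\<forall>i. let N = card (Bm i) + card (Bp i);
                    W = V (card (B0 i) + N)
                in \<exists>Jm Jp.
                     distinct Jm \<and> distinct Jp \<and> (\<forall>j\<in>set Jm \<union> set Jp. j < length W) \<and>
                     (!) W ` set Jm = Bm i \<and> (!) W ` set Jp = Bp i \<and>
                     real (sum_list (map (\<lambda>j. length (string_of_nat j)) (Jm @ Jp)))
                       \<le> c * real N * log 2 (real (card (B0 i) + N)) \<and>
                     D0 (prod_encode (prod_encode (list_encode Jm, list_encode Jp),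
                                      base_code \<P> (B0 i)))
                       = Some (prod_encode (base_code \<P> (Bm i), base_code \<P> (Bp i))) \<and>
                     D1 (prod_encode (prod_encode (list_encode Jm, list_encode Jp),
                                      base_code \<P> (noisy_base (B0 i) (Bm i) (Bp i))))
                       = Some (prod_encode (base_code \<P> (Bm i), base_code \<P> (Bp i))))))"


section \<open>Costs\<close>

(* l: code length, d: depth, h: hit overhead, f: access frequency. *)
definition cost_cache :: "real \<Rightarrow> real \<Rightarrow> real \<Rightarrow> nat \<Rightarrow> nat \<Rightarrow> real" where
  "cost_cache h \<rho> f l d = \<rho> * real l / f + real d / f + h"

definition cost_derive :: "nat \<Rightarrow> real" where
  "cost_derive d = real d"

definition cost_opt :: "real \<Rightarrow> real \<Rightarrow> real \<Rightarrow> nat \<Rightarrow> nat \<Rightarrow> real" where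
  "cost_opt h \<rho> f l d = min (cost_cache h \<rho> f l d) (cost_derive d)"

definition critical_frequency :: "real \<Rightarrow> real \<Rightarrow> nat \<Rightarrow> nat \<Rightarrow> real \<Rightarrow> bool" where
  "critical_frequency h \<rho> l d f \<longleftrightarrow> f > 0 \<and> cost_cache h \<rho> f l d = cost_derive d"

end

theory Submission
  imports Defs
begin

text \<open>
  Everything rests on two bounds for the conditional complexity. A derivation of length \<open>n'\<close> from
  a base of size \<open>m\<close> is a program of \<open>O(n')\<close> digits smaller than \<open>O(m + n')\<close>, so
  \<open>K(q | B) = O(n' log (m + n'))\<close>; genericity is the matching lower bound, and serializability
  replaces the trace length by the depth \<open>n\<close>. Hence the code length is \<open>\<Theta>(n log (m + n))\<close>, and
  (i) and (ii) become elementary. For (iii), the index lists of the noise, prefixed to a shortest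
  program for \<open>q\<close> given the clean base, form a program for \<open>q\<close> given the noisy base: it first
  restores the clean base with the decoder. The depth of \<open>q\<close> grows by at most the
  reconstruction depth, by induction along the premise relation.
\<close>

section \<open>Closure properties of partial recursive functions\<close>

text \<open>\<open>Kolm\<close> is built on raw partial recursive functions, so every informal
  program has to become a prefix machine with a partial recursive decoder. One machine,
  \<open>delimited_machine\<close>, serves both uses: a partial recursive \<open>\<psi>\<close>
  turns a self-delimiting header and the condition into a new condition, under which the rest of the
  program runs on \<open>U\<close>. For derivations the new condition is the code of
  \<open>q\<close>, and the rest is a fixed program that prints its condition; for noise it is the
  clean base code, and the rest is a shortest program for \<open>q\<close>. Only the bit length of
  the header matters, up to constant factors. For (ii), the hypothesis that the depth is at least
  log of the base size forces the depth to infinity along \<open>F\<close>. This makes the bounded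
  hit overhead negligible and keeps the constants of the exact critical frequency independent of
  \<open>\<rho>\<close>.\<close>

lemma computable_zero: "computable (\<lambda>n. 0)"
  unfolding computable_def by (rule partrec.zero)

lemma computable_comp: "computable f \<Longrightarrow> computable g \<Longrightarrow> computable (\<lambda>n. f (g n))"
  unfolding computable_def using partrec.comp[of "\<lambda>n. Some (f n)" "\<lambda>n. Some (g n)"] by simp

lemma partrec_comp_computable: "partrec f \<Longrightarrow> computable g \<Longrightarrow> partrec (\<lambda>n. f (g n))"
  unfolding computable_def using partrec.comp[of f "\<lambda>n. Some (g n)"] by simp

lemma computable_Suc: "computable f \<Longrightarrow> computable (\<lambda>n. Suc (f n))"
  using computable_comp[of Suc f] partrec.succ by (simp add: computable_def)

lemma computable_const: "computable (\<lambda>n. c)"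
  by (induction c) (auto intro: computable_zero computable_Suc)

lemma computable_fst: "computable f \<Longrightarrow> computable (\<lambda>n. fst (prod_decode (f n)))"
  using computable_comp[of "\<lambda>n. fst (prod_decode n)" f] partrec.left by (simp add: computable_def)

lemma computable_snd: "computable f \<Longrightarrow> computable (\<lambda>n. snd (prod_decode (f n)))"
  using computable_comp[of "\<lambda>n. snd (prod_decode n)" f] partrec.right by (simp add: computable_def)

lemma computable_pair:
  "computable f \<Longrightarrow> computable g \<Longrightarrow> computable (\<lambda>n. prod_encode (f n, g n))"
  unfolding computable_def
  using partrec.pair[of "\<lambda>n. Some (f n)" "\<lambda>n. Some (g n)"] by simp

lemma computable_id: "computable (\<lambda>n. n)"
  using computable_pair[of "\<lambda>n. fst (prod_decode n)" "\<lambda>n. snd (prod_decode n)"] partrec.left partrec.right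
  by (simp add: computable_def)

lemma computable_partrec: "computable f \<Longrightarrow> partrec (\<lambda>n. Some (f n))"
  by (simp add: computable_def)

named_theorems comp_intros
lemmas [comp_intros] = computable_const computable_id computable_Suc computable_fst computable_snd
  computable_pair

text \<open>The continuation \<open>h\<close> still sees the original input: it is run on the input
  paired with the result of \<open>f\<close>, since plain composition would forget
  \<open>n\<close>.\<close>

lemma partrec_bind:
  assumes "partrec f" "partrec (\<lambda>t. h (fst (prod_decode t)) (snd (prod_decode t)))"
  shows "partrec (\<lambda>n. Option.bind (f n) (\<lambda>x. h n x))"
proof -
  have "partrec (\<lambda>n. Option.bind (f n) (\<lambda>b. Some (prod_encode (n, b))))"
    using partrec.pair[OF computable_partrec[OF computable_id] assms(1)] by simp
  from partrec.comp[OF assms(2) this] show ?thesis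
    by (simp add: Option.bind_assoc)
qed

lemma partrec_rec:
  assumes "computable a" "computable k"
    and "partrec (\<lambda>t. s (fst (prod_decode t)) (fst (prod_decode (snd (prod_decode t))))
                       (snd (prod_decode (snd (prod_decode t)))))"
  shows "partrec (\<lambda>n. rec_nat (Some (a n)) (\<lambda>y r. Option.bind r (\<lambda>v. s n y v)) (k n))"
  using partrec_comp_computable[OF partrec.prec[OF computable_partrec[OF assms(1)] assms(3)]
      computable_pair[OF computable_id assms(2)]]
  by simp

lemma computable_rec:
  assumes "computable a" "computable k"
    and "computable (\<lambda>t. s (fst (prod_decode t)) (fst (prod_decode (snd (prod_decode t))))
                       (snd (prod_decode (snd (prod_decode t)))))"
  shows "computable (\<lambda>n. rec_nat (a n) (\<lambda>y r. s n y r) (k n))"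
proof -
  have "rec_nat (Some (a n)) (\<lambda>y r. Option.bind r (\<lambda>v. Some (s n y v))) j
      = Some (rec_nat (a n) (\<lambda>y r. s n y r) j)" for n j
    by (induction j) auto
  then show ?thesis
    using partrec_rec[OF assms(1,2) computable_partrec[OF assms(3)]] by (simp add: computable_def)
qed

lemma computable_add [comp_intros]:
  assumes "computable f" "computable g" shows "computable (\<lambda>n. f n + g n)"
proof -
  have "rec_nat (f n) (\<lambda>y r. Suc r) j = f n + j" for n j
    by (induction j) auto
  then show ?thesis
    using computable_rec[OF assms, of "\<lambda>n y r. Suc r"] by (simp add: comp_intros)
qed

lemma computable_mult [comp_intros]:
  assumes "computable f" "computable g" shows "computable (\<lambda>n. f n * g n)"
proof -
  have "rec_nat 0 (\<lambda>y r. r + f n) j = f n * j" for n j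
    by (induction j) auto
  then show ?thesis
    using computable_rec[OF computable_zero assms(2), of "\<lambda>n y r. r + f n"]
    by (simp add: comp_intros assms(1) computable_comp[of f])
qed

lemma computable_power [comp_intros]:
  assumes "computable f" "computable g" shows "computable (\<lambda>n. f n ^ g n)"
proof -
  have "rec_nat 1 (\<lambda>y r. r * f n) j = f n ^ j" for n j
    by (induction j) auto
  then show ?thesis
    using computable_rec[OF computable_const[of 1] assms(2), of "\<lambda>n y r. r * f n"]
    by (simp add: comp_intros computable_comp[of f] assms(1))
qed

lemma computable_diff [comp_intros]:
  assumes "computable f" "computable g" shows "computable (\<lambda>n. f n - g n)"
proof -
  have pred: "computable (\<lambda>n. n - Suc 0)"
  proof -
    have "rec_nat 0 (\<lambda>y r. y) j = j - Suc 0" for j :: nat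
      by (induction j) auto
    then show ?thesis
      using computable_rec[OF computable_zero computable_id, of "\<lambda>n y r. y"]
      by (simp add: comp_intros)
  qed
  have "rec_nat (f n) (\<lambda>y r. r - Suc 0) j = f n - j" for n j
    by (induction j) auto
  then show ?thesis
    using computable_rec[OF assms, of "\<lambda>n y r. r - Suc 0"]
    by (simp add: comp_intros computable_comp[OF pred])
qed

section \<open>Decidable predicates and unbounded search\<close>

lemma decidable_iff: "decidable {n. P n} \<longleftrightarrow> computable (\<lambda>n. if P n then 1 else 0)"
  by (simp add: decidable_def)

lemma decidable_less [comp_intros]:
  assumes "computable f" "computable g" shows "decidable {n. f n < g n}"
proof -
  have "(\<lambda>n. if f n < g n then 1 else 0) = (\<lambda>n. 1 - (1 - (g n - f n)))" by auto
  then show ?thesis unfolding decidable_iff by (simp only:) (intro comp_intros assms)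
qed

lemma decidable_not [comp_intros]:
  assumes "decidable {n. P n}" shows "decidable {n. \<not> P n}"
proof -
  have "(\<lambda>n. if \<not> P n then 1 else 0) = (\<lambda>n. 1 - (if P n then 1 else (0::nat)))" by auto
  then show ?thesis using assms unfolding decidable_iff by (simp only:) (intro comp_intros assms)
qed

lemma decidable_conj [comp_intros]:
  assumes "decidable {n. P n}" "decidable {n. Q n}" shows "decidable {n. P n \<and> Q n}"
proof -
  have "(\<lambda>n. if P n \<and> Q n then 1 else 0) = (\<lambda>n. (if P n then 1 else (0::nat)) * (if Q n then 1 else 0))"
    by auto
  then show ?thesis using assms unfolding decidable_iff by (simp only:) (intro comp_intros assms)
qed

lemma decidable_disj [comp_intros]:
  assumes "decidable {n. P n}" "decidable {n. Q n}" shows "decidable {n. P n \<or> Q n}"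
  using decidable_not[OF decidable_conj[OF assms[THEN decidable_not]]] by simp

lemma decidable_le [comp_intros]:
  assumes "computable f" "computable g" shows "decidable {n. f n \<le> g n}"
  using decidable_not[OF decidable_less[OF assms(2,1)]] by (simp add: not_less)

lemma decidable_eq [comp_intros]:
  fixes f g :: "nat \<Rightarrow> nat"
  assumes "computable f" "computable g" shows "decidable {n. f n = g n}"
  using decidable_conj[OF decidable_le[OF assms] decidable_le[OF assms(2,1)]] by (simp add: eq_iff)

lemma decidable_mem [comp_intros]:
  assumes "decidable A" "computable f" shows "decidable {n. f n \<in> A}"
  using computable_comp[OF _ assms(2)] assms(1) by (simp add: decidable_def)

lemma computable_if [comp_intros]:
  assumes "decidable {n. P n}" "computable f" "computable g"
  shows "computable (\<lambda>n. if P n then f n else g n)"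
proof -
  have "(\<lambda>n. if P n then f n else g n)
      = (\<lambda>n. (if P n then 1 else 0) * f n + (1 - (if P n then 1 else 0)) * g n)" by auto
  then show ?thesis using assms unfolding decidable_iff by (simp only:) (intro comp_intros assms)
qed

text \<open>The characteristic function of \<open>P\<close> is total, so the demand of
  \<open>mu\<close> that all earlier values be defined and positive reduces to the failure of
  \<open>P\<close> there.\<close>

lemma partrec_search:
  assumes "decidable {t. P (fst (prod_decode t)) (snd (prod_decode t))}"
  shows "partrec (\<lambda>n. if \<exists>k. P n k then Some (LEAST k. P n k) else None)"
proof -
  let ?f = "\<lambda>t. Some (if P (fst (prod_decode t)) (snd (prod_decode t)) then 0 else 1 :: nat)"
  have "partrec ?f"
    by (intro computable_partrec comp_intros assms)
  from partrec.minim[OF this]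
  have "partrec (\<lambda>n. mu (\<lambda>k. Some (if P n k then 0 else 1)))" by simp
  moreover have "mu (\<lambda>k. Some (if P n k then 0 else 1))
     = (if \<exists>k. P n k then Some (LEAST k. P n k) else None)" for n
  proof (cases "\<exists>k. P n k")
    case True
    then have "P n (LEAST k. P n k)" by (rule LeastI_ex)
    moreover have "\<forall>j<(LEAST k. P n k). \<not> P n j" using not_less_Least by blast
    ultimately have "\<exists>k. P n k \<and> (\<forall>j<k. \<not> P n j)" by blast
    then show ?thesis by (auto simp: mu_def)
  qed (auto simp: mu_def)
  ultimately show ?thesis by simp
qed

lemma computable_Least:
  assumes "decidable {t. P (fst (prod_decode t)) (snd (prod_decode t))}" "\<And>n. \<exists>k. P n k"
  shows "computable (\<lambda>n. LEAST k. P n k)"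
  using partrec_search[OF assms(1)] assms(2) by (simp add: computable_def)

lemma decidable_bex [comp_intros]:
  assumes "decidable {t. P (fst (prod_decode t)) (snd (prod_decode t))}" "computable k"
  shows "decidable {n. \<exists>i<k n. P n i}"
proof -
  let ?s = "\<lambda>n y r. if P n y then 1 else (r :: nat)"
  have eq: "rec_nat 0 (?s n) j = (if \<exists>i<j. P n i then 1 else 0)" for n j
    by (induction j) (auto simp: less_Suc_eq)
  have "decidable {t. P (fst (prod_decode t)) (fst (prod_decode (snd (prod_decode t))))}"
    using decidable_mem[OF assms(1), of "\<lambda>t. prod_encode (fst (prod_decode t), fst (prod_decode (snd (prod_decode t))))"]
    by (simp add: comp_intros)
  then have "computable (\<lambda>n. rec_nat 0 (?s n) (k n))"
    by (intro computable_rec[of "\<lambda>_. 0" k ?s]) (intro comp_intros assms)+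
  then show ?thesis unfolding decidable_iff by (simp add: eq)
qed

text \<open>The quotient is the least \<open>k\<close> whose next multiple of the divisor exceeds
  the dividend. The disjunct \<open>g n = 0\<close> makes the search stop at 0, in accordance with
  \<open>x div 0 = 0\<close>.\<close>

lemma computable_div [comp_intros]:
  assumes "computable f" "computable g" shows "computable (\<lambda>n. f n div g n :: nat)"
proof -
  have quot: "g n = 0 \<or> f n < Suc k * g n \<longleftrightarrow> f n div g n \<le> k" for n k
    by (cases "g n = 0") (auto simp: div_less_iff_less_mult[symmetric] less_Suc_eq_le simp del: mult_Suc)
  have eq: "(LEAST k. g n = 0 \<or> f n < Suc k * g n) = f n div g n" for n
    unfolding quot by (rule Least_equality) auto
  have "decidable {t. g (fst (prod_decode t)) = 0 \<or>
          f (fst (prod_decode t)) < Suc (snd (prod_decode t)) * g (fst (prod_decode t))}"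
    by (intro comp_intros computable_comp[OF assms(1)] computable_comp[OF assms(2)])
  moreover have "\<exists>k. g n = 0 \<or> f n < Suc k * g n" for n
    unfolding quot by blast
  ultimately show ?thesis
    using computable_Least[of "\<lambda>n k. g n = 0 \<or> f n < Suc k * g n"] by (simp only: eq)
qed

lemma computable_mod [comp_intros]:
  assumes "computable f" "computable g" shows "computable (\<lambda>n. f n mod g n :: nat)"
  unfolding modulo_nat_def by (intro comp_intros assms)

section \<open>Computing with encoded lists\<close>

text \<open>On list codes, with the junk values \<open>lhd 0 = ltl 0 = 0\<close> for the empty list.\<close>

definition lhd :: "nat \<Rightarrow> nat" where "lhd l = fst (prod_decode (l - Suc 0))"
definition ltl :: "nat \<Rightarrow> nat" where "ltl l = snd (prod_decode (l - Suc 0))"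
definition ldrop :: "nat \<Rightarrow> nat \<Rightarrow> nat" where "ldrop l k = rec_nat l (\<lambda>_ r. ltl r) k"
definition lnth :: "nat \<Rightarrow> nat \<Rightarrow> nat" where "lnth l k = lhd (ldrop l k)"
definition llen :: "nat \<Rightarrow> nat" where "llen l = (LEAST k. ldrop l k = 0)"

lemma lhd_Cons [simp]: "lhd (list_encode (x # xs)) = x"
  by (simp add: lhd_def)

lemma ltl_Cons [simp]: "ltl (list_encode (x # xs)) = list_encode xs"
  by (simp add: ltl_def)

text \<open>The junk value makes the empty list a fixed point, so \<open>ldrop\<close> stays at 0
  beyond the end, just as \<open>drop\<close> stays at the empty list.\<close>

lemma ltl_0 [simp]: "ltl 0 = 0"
proof -
  have "prod_decode 0 = (0, 0)"
    using prod_encode_inverse[of "(0, 0)"] by (simp add: prod_encode_def)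
  then show ?thesis by (simp add: ltl_def)
qed

lemma list_encode_eq_0_iff [simp]: "list_encode xs = 0 \<longleftrightarrow> xs = []"
  by (cases xs) auto

lemma ldrop_list_encode: "ldrop (list_encode xs) k = list_encode (drop k xs)"
proof (induction k)
  case (Suc k)
  have "ltl (list_encode ys) = list_encode (tl ys)" for ys
    by (cases ys) (simp_all del: list_encode.simps(2))
  with Suc show ?case by (simp add: ldrop_def drop_Suc tl_drop)
qed (simp add: ldrop_def)

lemma lnth_list_encode: "k < length xs \<Longrightarrow> lnth (list_encode xs) k = xs ! k"
  using lhd_Cons[of "xs ! k" "drop (Suc k) xs"] by (simp only: lnth_def ldrop_list_encode Cons_nth_drop_Suc)

lemma llen_list_encode: "llen (list_encode xs) = length xs"
  unfolding llen_def ldrop_list_encode by (rule Least_equality) simp_all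

lemma computable_lhd [comp_intros]: "computable f \<Longrightarrow> computable (\<lambda>n. lhd (f n))"
  unfolding lhd_def by (intro comp_intros)

lemma computable_ltl [comp_intros]: "computable f \<Longrightarrow> computable (\<lambda>n. ltl (f n))"
  unfolding ltl_def by (intro comp_intros)

lemma computable_ldrop [comp_intros]:
  "computable f \<Longrightarrow> computable g \<Longrightarrow> computable (\<lambda>n. ldrop (f n) (g n))"
  unfolding ldrop_def by (rule computable_rec[of f g "\<lambda>n y r. ltl r"]) (assumption | intro comp_intros)+

lemma computable_lnth [comp_intros]:
  "computable f \<Longrightarrow> computable g \<Longrightarrow> computable (\<lambda>n. lnth (f n) (g n))"
  unfolding lnth_def by (intro comp_intros)

lemma computable_llen [comp_intros]: "computable f \<Longrightarrow> computable (\<lambda>n. llen (f n))"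
proof (rule computable_comp[of llen])
  have "\<exists>k. ldrop l k = 0" for l
    using ldrop_list_encode[of "list_decode l" "length (list_decode l)"] by auto
  moreover have "decidable {t. ldrop (fst (prod_decode t)) (snd (prod_decode t)) = 0}"
    by (intro comp_intros)
  ultimately show "computable llen"
    unfolding llen_def by (intro computable_Least)
qed

lemma computable_cons [comp_intros]:
  "computable f \<Longrightarrow> computable g \<Longrightarrow> computable (\<lambda>n. list_encode (f n # list_decode (g n)))"
  by (simp, intro comp_intros)

lemma decidable_list_mem [comp_intros]:
  assumes "computable f" "computable g"
  shows "decidable {n. f n \<in> set (list_decode (g n))}"
proof -
  have "x \<in> set (list_decode l) \<longleftrightarrow> (\<exists>i<llen l. x = lnth l i)" for x l
    using llen_list_encode[of "list_decode l"] lnth_list_encode[of _ "list_decode l"]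
    by (auto simp: in_set_conv_nth)
  moreover have "decidable {n. \<exists>i<llen (g n). f n = lnth (g n) i}"
    by (intro comp_intros assms computable_comp[OF assms(1) computable_fst] computable_comp[OF assms(2) computable_fst])
  ultimately show ?thesis by simp
qed

text \<open>Gives a computable bound for enumerating the set that a list code represents.\<close>

lemma mem_less_list_encode: "x \<in> set xs \<Longrightarrow> x < list_encode xs"
proof (induction xs)
  case (Cons y ys)
  then show ?case
    using le_prod_encode_1[of y "list_encode ys"] le_prod_encode_2[of "list_encode ys" y] by auto
qed simp

lemma computable_sorted_list:
  assumes "decidable {t. P (fst (prod_decode t)) (snd (prod_decode t))}" "computable b"
  shows "computable (\<lambda>n. list_encode (sorted_list_of_set {x. x < b n \<and> P n x}))"
proof -
  \<comment> \<open>Round \<open>y\<close> treats the candidate \<open>b n - Suc y\<close>. Each hit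
    is put in front, so descending candidates yield an ascending list.\<close>
  let ?s = "\<lambda>n y r. if P n (b n - Suc y) then Suc (prod_encode (b n - Suc y, r)) else r"
  have b: "computable (\<lambda>n. b (f n))" if "computable f" for f
    using computable_comp[OF assms(2) that] .
  have "computable (\<lambda>t. prod_encode (fst (prod_decode t),
          b (fst (prod_decode t)) - Suc (fst (prod_decode (snd (prod_decode t))))))"
    by (intro comp_intros b)
  from decidable_mem[OF assms(1) this]
  have "decidable {t. P (fst (prod_decode t))
          (b (fst (prod_decode t)) - Suc (fst (prod_decode (snd (prod_decode t)))))}"
    by simp
  then have "computable (\<lambda>n. rec_nat 0 (?s n) (b n))"
    by (intro computable_rec[of "\<lambda>_. 0" b ?s] computable_const assms) (intro comp_intros b)
  moreover have "rec_nat 0 (?s n) k = list_encode (filter (P n) [b n - k..<b n])" if "k \<le> b n" for n k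
    using that
  proof (induction k)
    case (Suc k)
    then have "[b n - Suc k..<b n] = (b n - Suc k) # [b n - k..<b n]"
      by (simp add: Suc_diff_Suc upt_conv_Cons)
    with Suc show ?case by simp
  qed simp
  moreover have "sorted_list_of_set {x. x < b n \<and> P n x} = filter (P n) [0..<b n]" for n
  proof -
    have "set (filter (P n) [0..<b n]) = {x. x < b n \<and> P n x}" by auto
    moreover have "sorted (filter (P n) [0..<b n])" by (simp add: sorted_wrt_filter)
    ultimately show ?thesis
      using sorted_list_of_set.idem_if_sorted_distinct[of "filter (P n) [0..<b n]"] by simp
  qed
  ultimately show ?thesis by simp
qed

section \<open>Iterating a partial step along an encoded list\<close>

fun foldM :: "('d \<Rightarrow> 'a \<Rightarrow> 'a option) \<Rightarrow> 'd list \<Rightarrow> 'a \<Rightarrow> 'a option" where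
  "foldM g [] a = Some a"
| "foldM g (d # ds) a = Option.bind (g d a) (foldM g ds)"

lemma foldM_append: "foldM g (ds @ es) a = Option.bind (foldM g ds a) (foldM g es)"
  by (induction ds arbitrary: a) (auto simp: Option.bind_assoc intro!: arg_cong2[of _ _ _ _ Option.bind])

text \<open>Entries are read by position, so recursion on the list length suffices; after
  \<open>k\<close> rounds the state is the fold of the first \<open>k\<close> entries.\<close>

lemma partrec_foldM:
  assumes "partrec (\<lambda>t. g (fst (prod_decode t)) (snd (prod_decode t)))"
  shows "partrec (\<lambda>t. foldM g (list_decode (fst (prod_decode t))) (snd (prod_decode t)))"
proof -
  let ?s = "\<lambda>n y v. g (lnth (fst (prod_decode n)) y) v"
  have "partrec (\<lambda>t. ?s (fst (prod_decode t)) (fst (prod_decode (snd (prod_decode t))))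
                        (snd (prod_decode (snd (prod_decode t)))))"
    using partrec_comp_computable[OF assms, of "\<lambda>t. prod_encode (lnth (fst (prod_decode (fst (prod_decode t)))) (fst (prod_decode (snd (prod_decode t)))), snd (prod_decode (snd (prod_decode t))))"]
    by (simp add: comp_intros)
  then have "partrec (\<lambda>n. rec_nat (Some (snd (prod_decode n))) (\<lambda>y r. Option.bind r (?s n y))
                        (llen (fst (prod_decode n))))"
    by (intro partrec_rec) (intro comp_intros)+
  moreover have "rec_nat (Some a) (\<lambda>y r. Option.bind r (g (lnth (list_encode ds) y))) k = foldM g (take k ds) a"
    if "k \<le> length ds" for ds a k
    using that
  proof (induction k)
    case (Suc k)
    have "foldM g [d] a = g d a" for d a
      by (cases "g d a") simp_all
    then have "foldM g [d] = g d" for d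
      by (simp only: fun_eq_iff) simp
    with Suc show ?case
      by (simp add: take_Suc_conv_app_nth foldM_append lnth_list_encode del: foldM.simps(2))
  qed simp
  from this[of "length (list_decode l)" "list_decode l" for l]
  have "rec_nat (Some a) (\<lambda>y r. Option.bind r (g (lnth l y))) (llen l) = foldM g (list_decode l) a" for l a
    using llen_list_encode[of "list_decode l"] by simp
  ultimately show ?thesis by simp
qed

section \<open>Prefix machines with a self-delimiting header\<close>

lemma nat_of_string_append:
  "nat_of_string (xs @ ys) = nat_of_string xs + 2 ^ length xs * nat_of_string ys"
  by (induction xs) (auto simp: algebra_simps)

lemma nat_of_string_replicate_False: "Suc (nat_of_string (replicate k False)) = 2 ^ k"
  by (induction k) auto

lemma nat_of_string_ge: "2 ^ length p \<le> Suc (nat_of_string p)"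
  by (induction p) auto

lemma nat_of_string_less: "Suc (nat_of_string p) < 2 ^ Suc (length p)"
  by (induction p) auto

lemma nat_of_string_inject: "nat_of_string p = nat_of_string p' \<longleftrightarrow> p = p'"
proof
  show "p = p'" if "nat_of_string p = nat_of_string p'"
    using that
  proof (induction p arbitrary: p')
    case Nil
    then show ?case by (cases p') (auto split: if_splits)
  next
    case (Cons b bs)
    then obtain b' bs' where p': "p' = b' # bs'"
      by (cases p') (auto split: if_splits)
    with Cons.prems have "2 * nat_of_string bs + (if b then 2 else 1)
      = 2 * nat_of_string bs' + (if b' then 2 else 1)" by simp
    then have "b = b' \<and> nat_of_string bs = nat_of_string bs'"
      by (auto split: if_splits) presburger+
    with Cons.IH p' show ?case by blast
  qed
qed simp

lemma nat_of_string_surj: "\<exists>p. nat_of_string p = n"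
proof (induction n rule: less_induct)
  case (less n)
  show ?case
  proof (cases "n = 0")
    case True
    then show ?thesis by (intro exI[of _ "[]"]) simp
  next
    case False
    \<comment> \<open>The digits of this numeration are 1 and 2, so the lowest one is 2 exactly when
      \<open>n\<close> is even.\<close>
    define b where "b = even n"
    define k where "k = (n - (if b then 2 else 1)) div 2"
    have "n = 2 * k + (if b then 2 else 1)" "k < n"
      using False unfolding b_def k_def by presburger+
    with less.IH[of k] obtain bs where "nat_of_string bs = k" by blast
    then have "nat_of_string (b # bs) = n"
      using \<open>n = 2 * k + _\<close> by simp
    then show ?thesis by blast
  qed
qed

text \<open>The successors of the numbers of strings of length \<open>L\<close> fill the interval
  from 2^L to 2^(L+1), and these intervals are disjoint. String length thereby becomes an arithmetic
  condition.\<close>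

lemma length_eqI_nat_of_string:
  assumes "2 ^ L \<le> Suc (nat_of_string p)" "Suc (nat_of_string p) < 2 ^ Suc L"
  shows "length p = L"
proof -
  have "(2::nat) ^ L < 2 ^ Suc (length p)"
    using assms nat_of_string_less[of p] by linarith
  moreover have "(2::nat) ^ length p < 2 ^ Suc L"
    using assms nat_of_string_ge[of p] by linarith
  ultimately have "L < Suc (length p)" "length p < Suc L"
    by (auto intro: power_less_imp_less_exp[rotated] simp del: power_Suc)
  then show ?thesis by simp
qed

text \<open>
  \<open>header n k\<close>: the string numbered \<open>n\<close> is \<open>False\<^sup>L True w t\<close> with \<open>|w| = L\<close>, where \<open>k\<close> codes \<open>L\<close>
  and the numbers \<open>v\<close>, \<open>s\<close> of \<open>w\<close>, \<open>t\<close>. The first two conjuncts say that \<open>v\<close> is the number of a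
  string of length \<open>L\<close>.
\<close>

definition header :: "nat \<Rightarrow> nat \<Rightarrow> bool" where
  "header n k = (case prod_decode k of (L, vs) \<Rightarrow> case prod_decode vs of (v, s) \<Rightarrow>
     2 ^ L \<le> Suc v \<and> Suc v < 2 ^ Suc L \<and> Suc n = 2 ^ L * (2 * (v + 2 ^ L * s) + 3))"

text \<open>The run of \<open>False\<close> has number 2^L - 1 and \<open>True\<close> is the digit
  2 at weight 2^L; after adding one, 2^L factors out and leaves 2 x + 3, where \<open>x\<close> is
  the number of \<open>w @ t\<close>.\<close>

lemma nat_of_string_delimited:
  "Suc (nat_of_string (replicate (length w) False @ True # w @ t))
     = 2 ^ length w * (2 * (nat_of_string w + 2 ^ length w * nat_of_string t) + 3)"
  using nat_of_string_replicate_False[of "length w"]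
  by (simp add: nat_of_string_append algebra_simps)

text \<open>Parsing becomes a decidable arithmetic relation. The decoder can therefore search for
  the parse, and it diverges on strings that have none.\<close>

lemma header_iff:
  "header (nat_of_string p) k \<longleftrightarrow>
    (\<exists>w t. p = replicate (length w) False @ True # w @ t \<and>
           k = prod_encode (length w, prod_encode (nat_of_string w, nat_of_string t)))"
proof
  obtain L v s where k: "k = prod_encode (L, prod_encode (v, s))"
    using prod_decode_inverse by (metis prod.collapse)
  obtain w t where w: "nat_of_string w = v" and t: "nat_of_string t = s"
    using nat_of_string_surj by metis
  assume h: "header (nat_of_string p) k"
  then have "length w = L"
    using w by (intro length_eqI_nat_of_string) (auto simp: header_def k)
  moreover from this have "Suc (nat_of_string p) = Suc (nat_of_string (replicate (length w) False @ True # w @ t))"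
    using h w t unfolding nat_of_string_delimited by (simp add: header_def k)
  ultimately show "\<exists>w t. p = replicate (length w) False @ True # w @ t \<and>
           k = prod_encode (length w, prod_encode (nat_of_string w, nat_of_string t))"
    using w t k nat_of_string_inject by auto
next
  assume "\<exists>w t. p = replicate (length w) False @ True # w @ t \<and>
           k = prod_encode (length w, prod_encode (nat_of_string w, nat_of_string t))"
  then show "header (nat_of_string p) k"
    using nat_of_string_delimited nat_of_string_ge nat_of_string_less
    by (auto simp: header_def)
qed

text \<open>The position of the first \<open>True\<close> reveals the length of \<open>w\<close>,
  and this fixes where \<open>t\<close> begins.\<close>

lemma delimited_eqD:
  assumes "replicate (length w) False @ True # w @ t = replicate (length w') False @ True # w' @ t'"
  shows "w = w' \<and> t = t'"
proof -
  have "takeWhile (\<lambda>b. \<not> b) (replicate (length w) False @ True # w @ t) = replicate (length w) False"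
    for w t :: "bool list" by (simp add: takeWhile_append)
  then have "replicate (length w) False = replicate (length w') False"
    using assms by metis
  then have "length w = length w'" by (metis length_replicate)
  with assms show ?thesis by simp
qed

lemma decidable_header: "decidable {t. header (fst (prod_decode (fst (prod_decode t)))) (snd (prod_decode t))}"
  unfolding header_def case_prod_beta by (intro comp_intros)

text \<open>The header is self-delimiting so that it can be split off without reference to the
  programs of \<open>U\<close>. \<open>SOME\<close> picks the only parse there is.\<close>

definition delimited_machine ::
    "(nat \<Rightarrow> nat option) \<Rightarrow> (bool list \<Rightarrow> nat \<Rightarrow> nat option) \<Rightarrow> bool list \<Rightarrow> nat \<Rightarrow> nat option" where
  "delimited_machine \<psi> U p y =
     (if \<exists>w t. p = replicate (length w) False @ True # w @ t then
        (case SOME (w, t). p = replicate (length w) False @ True # w @ t of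
          (w, t) \<Rightarrow> Option.bind (\<psi> (prod_encode (nat_of_string w, y))) (U t))
      else None)"

lemma delimited_machine_delimited [simp]:
  "delimited_machine \<psi> U (replicate (length w) False @ True # w @ t) y
     = Option.bind (\<psi> (prod_encode (nat_of_string w, y))) (U t)"
proof -
  let ?P = "\<lambda>(w', t'). replicate (length w) False @ True # w @ t = replicate (length w') False @ True # w' @ t'"
  have "(SOME wt. ?P wt) = (w, t)"
    by (rule some_equality) (auto dest: delimited_eqD)
  then show ?thesis by (auto simp: delimited_machine_def)
qed

lemma prefix_machine_delimited:
  assumes U: "prefix_machine U" and \<psi>: "partrec \<psi>"
  shows "prefix_machine (delimited_machine \<psi> U)"
proof -
  from U obtain u where u: "partrec u" "\<And>p y. u (prod_encode (nat_of_string p, y)) = U p y"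
    by (auto simp: prefix_machine_def)
  define \<phi> where "\<phi> n k = Option.bind (\<psi> (prod_encode (fst (prod_decode (snd (prod_decode k))), snd (prod_decode n))))
      (\<lambda>y'. u (prod_encode (snd (prod_decode (snd (prod_decode k))), y')))" for n k
  define g where "g n = Option.bind
      (if \<exists>k. header (fst (prod_decode n)) k then Some (LEAST k. header (fst (prod_decode n)) k) else None)
      (\<phi> n)" for n
  have "partrec (\<lambda>t. \<phi> (fst (prod_decode t)) (snd (prod_decode t)))"
    unfolding \<phi>_def
    by (intro partrec_bind partrec_comp_computable[OF \<psi>] partrec_comp_computable[OF u(1)] comp_intros)
  then have "partrec g"
    unfolding g_def by (intro partrec_bind partrec_search decidable_header)
  moreover have "g (prod_encode (nat_of_string p, y)) = delimited_machine \<psi> U p y" for p y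
  proof (cases "\<exists>w t. p = replicate (length w) False @ True # w @ t")
    case True
    then obtain w t where p: "p = replicate (length w) False @ True # w @ t" by blast
    let ?k = "prod_encode (length w, prod_encode (nat_of_string w, nat_of_string t))"
    have k: "header (nat_of_string p) k \<longleftrightarrow> k = ?k" for k
      unfolding header_iff p by (auto dest: delimited_eqD)
    have least: "(LEAST k. header (nat_of_string p) k) = ?k"
      by (rule Least_equality) (auto simp: k)
    have "\<exists>k. header (nat_of_string p) k"
      by (auto simp: k)
    with least have "g (prod_encode (nat_of_string p, y)) = \<phi> (prod_encode (nat_of_string p, y)) ?k"
      unfolding g_def prod_encode_inverse fst_conv by (simp only: if_True bind.bind_lunit)
    also have "\<dots> = Option.bind (\<psi> (prod_encode (nat_of_string w, y))) (U t)"
      unfolding \<phi>_def prod_encode_inverse fst_conv snd_conv u(2) ..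
    also have "\<dots> = delimited_machine \<psi> U p y"
      unfolding p delimited_machine_delimited ..
    finally show ?thesis .
  next
    case False
    then have "\<not> header (nat_of_string p) k" for k
      unfolding header_iff by blast
    with False show ?thesis
      by (auto simp: g_def delimited_machine_def)
  qed
  moreover have "p = p'" if M: "delimited_machine \<psi> U p y \<noteq> None" "delimited_machine \<psi> U p' y \<noteq> None"
    and pre: "prefix p p'" for y p p'
  proof -
    have "\<exists>w t. p = replicate (length w) False @ True # w @ t" if "delimited_machine \<psi> U p y \<noteq> None" for p
      using that by (auto simp: delimited_machine_def split: if_splits)
    from this[OF M(1)] this[OF M(2)] obtain w t w' t' where p: "p = replicate (length w) False @ True # w @ t"
      and p': "p' = replicate (length w') False @ True # w' @ t'" by blast
    from pre obtain r where r: "p' = p @ r" by (auto simp: prefix_def)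
    \<comment> \<open>Comparable programs share their header, hence also the new condition; the
      tails are then comparable programs of \<open>U\<close> under one and the same
      condition.\<close>
    have w': "w' = w" and t': "t' = t @ r"
      using delimited_eqD[of w "t @ r" w' t'] p p' r by simp_all
    have "Option.bind (\<psi> (prod_encode (nat_of_string w, y))) (U t) \<noteq> None"
      "Option.bind (\<psi> (prod_encode (nat_of_string w, y))) (U t') \<noteq> None"
      using M unfolding p p' delimited_machine_delimited w' by blast+
    then obtain y' where "U t y' \<noteq> None" "U t' y' \<noteq> None"
      by (cases "\<psi> (prod_encode (nat_of_string w, y))") simp_all
    moreover have "prefix t t'" by (simp add: t')
    ultimately have "t = t'"
      using U unfolding prefix_machine_def by blast
    then show ?thesis unfolding p p' w' by simp
  qed
  ultimately show ?thesis
    unfolding prefix_machine_def by (intro conjI exI[of _ g] allI impI) (simp_all, blast)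
qed

section \<open>Programs for the universal machine\<close>

lemma universal_simulates:
  assumes "universal_prefix_machine U" "prefix_machine M"
  obtains c where "\<And>p x y. M p y = Some x \<Longrightarrow> \<exists>p'. U p' y = Some x \<and> length p' \<le> length p + c"
  using assms unfolding universal_prefix_machine_def by blast

text \<open>The factor 2 pays for \<open>w\<close> and for its length in unary; the separator
  \<open>True\<close> goes into the constant.\<close>

lemma universal_delimited:
  assumes U: "universal_prefix_machine U" and "partrec \<psi>"
  obtains c where "\<And>v L y y' p x. v < 2 ^ L \<Longrightarrow> \<psi> (prod_encode (v, y)) = Some y' \<Longrightarrow> U p y' = Some x \<Longrightarrow>
     \<exists>p'. U p' y = Some x \<and> length p' \<le> length p + 2 * L + c"
proof -
  have "prefix_machine (delimited_machine \<psi> U)"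
    using assms by (intro prefix_machine_delimited) (auto simp: universal_prefix_machine_def)
  then obtain c where c: "\<And>p x y. delimited_machine \<psi> U p y = Some x \<Longrightarrow>
      \<exists>p'. U p' y = Some x \<and> length p' \<le> length p + c"
    using universal_simulates[OF U] by blast
  show ?thesis
  proof (rule that)
    fix v L :: nat and y y' p x
    assume v: "v < 2 ^ L" and "\<psi> (prod_encode (v, y)) = Some y'" "U p y' = Some x"
    moreover obtain w where w: "nat_of_string w = v" using nat_of_string_surj by blast
    ultimately obtain p' where p': "U p' y = Some x"
      "length p' \<le> length (replicate (length w) False @ True # w @ p) + c"
      using c[of "replicate (length w) False @ True # w @ p" y x] by auto
    have "(2::nat) ^ length w \<le> 2 ^ L"
      using nat_of_string_ge[of w] w v by linarith
    then have "length w \<le> L" by simp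
    with p' show "\<exists>p'. U p' y = Some x \<and> length p' \<le> length p + 2 * L + Suc c"
      by (intro exI[of _ p']) simp
  qed
qed

lemma prefix_machine_empty_program:
  assumes "computable h"
  shows "prefix_machine (\<lambda>p y. if p = [] then Some (h y) else None)"
proof -
  \<comment> \<open>The predicate ignores \<open>k\<close>: the search returns 0 at once on the
    empty program and diverges on every other one.\<close>
  let ?P = "\<lambda>n k :: nat. fst (prod_decode n) = 0"
  let ?g = "\<lambda>n. Option.bind (if \<exists>k. ?P n k then Some (LEAST k. ?P n k) else None) (\<lambda>_. Some (h (snd (prod_decode n))))"
  have "partrec ?g"
    by (intro partrec_bind partrec_search computable_partrec computable_comp[OF assms] comp_intros)
  moreover have "?g (prod_encode (nat_of_string p, y)) = (if p = [] then Some (h y) else None)" for p y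
  proof -
    have "nat_of_string p = 0 \<longleftrightarrow> p = []"
      using nat_of_string_inject[of p "[]"] by simp
    then show ?thesis by simp
  qed
  ultimately show ?thesis
    unfolding prefix_machine_def by (intro conjI exI[of _ ?g] allI impI) (simp_all split: if_splits)
qed

text \<open>The bound is uniform in the condition. The identity as \<open>h\<close> gives a short
  program that prints its condition; a constant \<open>h\<close> shows that every output has a
  program, so that the \<open>LEAST\<close> in \<open>Kolm\<close> is attained.\<close>

lemma universal_constant:
  assumes "universal_prefix_machine U" "computable h"
  obtains c where "\<And>y. \<exists>p. U p y = Some (h y) \<and> length p \<le> c"
proof (rule universal_simulates[OF assms(1) prefix_machine_empty_program[OF assms(2)]])
  fix c
  assume c: "\<And>p x y. (if p = [] then Some (h y) else None) = Some x \<Longrightarrow>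
      \<exists>p'. U p' y = Some x \<and> length p' \<le> length p + c"
  show thesis
    by (rule that[of c]) (use c[of "[]"] in simp)
qed

lemma universal_total: "universal_prefix_machine U \<Longrightarrow> \<exists>p. U p y = Some x"
  by (metis universal_constant[OF _ computable_const])

lemma Kolm_le: "U p y = Some x \<Longrightarrow> Kolm U x y \<le> length p"
  unfolding Kolm_def by (rule Least_le) blast

lemma Kolm_witness:
  assumes "universal_prefix_machine U"
  obtains p where "U p y = Some x" "length p = Kolm U x y"
proof -
  have "\<exists>n p. length p = n \<and> U p y = Some x" using universal_total[OF assms] by blast
  from LeastI_ex[OF this] show ?thesis using that unfolding Kolm_def by auto
qed

section \<open>Packing digit lists into numbers\<close>

text \<open>
  A list code is doubly exponential in the length of the list, because Cantor pairing squares.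
  Programs therefore carry the list in positional notation together with its radix. Digits are
  shifted by one, so that a vanishing quotient marks the end.
\<close>

fun digit_value :: "nat \<Rightarrow> nat list \<Rightarrow> nat" where
  "digit_value D [] = 0"
| "digit_value D (d # ds) = Suc d + D * digit_value D ds"

definition unpack_step :: "nat \<Rightarrow> nat \<Rightarrow> nat" where
  "unpack_step D r = (if fst (prod_decode r) = 0 then r else
     prod_encode (fst (prod_decode r) div D, list_encode ((fst (prod_decode r) mod D - 1) # list_decode (snd (prod_decode r)))))"

text \<open>The argument pairs the radix with the packed number. The packed number also serves as
  the number of rounds: it is at least the number of digits, and rounds after the last digit are
  idle.\<close>

definition unpack :: "nat \<Rightarrow> nat" where
  "unpack v = snd (prod_decode (rec_nat (prod_encode (snd (prod_decode v), 0))
     (\<lambda>_. unpack_step (fst (prod_decode v))) (snd (prod_decode v))))"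

lemma computable_unpack: "computable unpack"
  unfolding unpack_def unpack_step_def
  by (intro comp_intros computable_rec)

text \<open>The lowest digit is split off first and ends up deepest in the list, hence the
  reversal.\<close>

lemma unpack_digit_value:
  assumes "\<forall>d\<in>set ds. Suc d < D"
  shows "unpack (prod_encode (D, digit_value D ds)) = list_encode (rev ds)"
proof -
  have iter: "rec_nat (prod_encode (digit_value D ds, list_encode acc)) (\<lambda>_. unpack_step D) k
      = prod_encode (digit_value D (drop k ds), list_encode (rev (take k ds) @ acc))" for k acc
  proof (induction k)
    case (Suc k)
    show ?case
    proof (cases "k < length ds")
      case True
      then have "drop k ds = ds ! k # drop (Suc k) ds" "take (Suc k) ds = take k ds @ [ds ! k]"
        by (simp_all add: Cons_nth_drop_Suc take_Suc_conv_app_nth)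
      moreover have "Suc (ds ! k) < D" using assms True by simp
      then have "Suc (ds ! k + D * x) div D = x" "Suc (ds ! k + D * x) mod D = Suc (ds ! k)" for x
        using div_mult_self2[of D "Suc (ds ! k)" x] mod_mult_self2[of "Suc (ds ! k)" D x] by simp_all
      ultimately show ?thesis using Suc by (simp add: unpack_step_def)
    qed (use Suc in \<open>simp add: unpack_step_def\<close>)
  qed simp
  have "length ds \<le> digit_value D ds"
    using assms
  proof (induction ds)
    case (Cons d ds)
    then have "1 * digit_value D ds \<le> D * digit_value D ds" by (intro mult_le_mono1) simp
    moreover have "length ds \<le> digit_value D ds" using Cons by simp
    ultimately show ?case unfolding digit_value.simps list.size by linarith
  qed simp
  with iter[of "[]"] show ?thesis by (simp add: unpack_def)
qed

lemma digit_value_less: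
  assumes "\<forall>d\<in>set ds. Suc d < D"
  shows "digit_value D ds < D ^ length ds"
  using assms
proof (induction ds)
  case (Cons d ds)
  then have "Suc (digit_value D ds) \<le> D ^ length ds" by simp
  then have "D * Suc (digit_value D ds) \<le> D * D ^ length ds" by (rule mult_le_mono2)
  with Cons.prems show ?case by simp
qed simp

text \<open>A single pairing squares its arguments only once, so attaching the radix merely doubles
  the bit length.\<close>

lemma prod_encode_less: "prod_encode (x, y) < (x + y + 1) ^ 2"
proof -
  have "2 * triangle k = k * Suc k" for k
    by (induction k) auto
  from this[of "x + y"] have "triangle (x + y) \<le> (x + y) * Suc (x + y)" by simp
  then show ?thesis
    by (simp add: prod_encode_def power2_eq_square)
qed

lemma unpack_surj:
  assumes b: "1 \<le> b" and ds: "\<forall>d\<in>set ds. Suc d < 2 ^ b"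
  shows "\<exists>v < 2 ^ (2 * b * (length ds + 2)). unpack v = list_encode ds"
proof -
  define D :: nat where "D = 2 ^ b"
  have D: "2 \<le> D" using b power_increasing[of 1 b "2::nat"] by (simp add: D_def)
  have ds': "\<forall>d\<in>set (rev ds). Suc d < D" using ds by (simp add: D_def)
  let ?w = "digit_value D (rev ds)"
  have w: "?w < D ^ length ds" using digit_value_less[OF ds'] by simp
  \<comment> \<open>The two extra digits in the bound arise here: one factor \<open>D\<close> makes
    \<open>?X\<close> dominate both the radix and \<open>?w + 1\<close>, a second one covers their
    sum.\<close>
  let ?X = "D * D ^ length ds"
  have "D * 1 \<le> ?X" using D by (intro mult_le_mono2) simp
  moreover have "1 * D ^ length ds \<le> ?X" using D by (intro mult_le_mono1) simp
  moreover have "2 * ?X \<le> D * ?X" using D by (intro mult_le_mono1)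
  ultimately have "D + ?w + 1 \<le> D * ?X" using w by linarith
  then have "D + ?w + 1 \<le> D ^ (length ds + 2)" by simp
  then have "(D + ?w + 1) ^ 2 \<le> (D ^ (length ds + 2)) ^ 2" by (rule power_mono) simp
  also have "\<dots> = 2 ^ (2 * b * (length ds + 2))"
    unfolding D_def power_mult[symmetric] by (rule arg_cong[of _ _ "power 2"]) simp
  finally have "prod_encode (D, ?w) < 2 ^ (2 * b * (length ds + 2))"
    using prod_encode_less[of D ?w] by linarith
  with unpack_digit_value[OF ds'] show ?thesis by auto
qed

text \<open>The price of a digit list is \<open>b\<close> bits per digit, doubled by the pairing
  with the radix and doubled again by the header.\<close>

lemma universal_digits:
  assumes U: "universal_prefix_machine U" and \<psi>: "partrec \<psi>"
  obtains c where "\<And>ds b y y' p x. 1 \<le> b \<Longrightarrow> \<forall>d\<in>set ds. Suc d < 2 ^ b \<Longrightarrow>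
     \<psi> (prod_encode (list_encode ds, y)) = Some y' \<Longrightarrow> U p y' = Some x \<Longrightarrow>
     \<exists>p'. U p' y = Some x \<and> length p' \<le> length p + 4 * b * (length ds + 2) + c"
proof -
  have "computable (\<lambda>n. prod_encode (unpack (fst (prod_decode n)), snd (prod_decode n)))"
    by (intro comp_intros computable_comp[OF computable_unpack])
  from universal_delimited[OF U partrec_comp_computable[OF \<psi> this]]
  obtain c where c: "\<And>v L y y' p x. v < 2 ^ L \<Longrightarrow> \<psi> (prod_encode (unpack v, y)) = Some y' \<Longrightarrow>
      U p y' = Some x \<Longrightarrow> \<exists>p'. U p' y = Some x \<and> length p' \<le> length p + 2 * L + c"
    by auto
  show ?thesis
  proof (rule that)
    fix ds b y y' p x
    assume "1 \<le> b" "\<forall>d\<in>set ds. Suc d < 2 ^ b"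
      and run: "\<psi> (prod_encode (list_encode ds, y)) = Some y'" "U p y' = Some x"
    then obtain v where "v < 2 ^ (2 * b * (length ds + 2))" "unpack v = list_encode ds"
      using unpack_surj by blast
    with c[of v "2 * b * (length ds + 2)" y y' p x] run
    show "\<exists>p'. U p' y = Some x \<and> length p' \<le> length p + 4 * b * (length ds + 2) + c"
      by (simp add: algebra_simps)
  qed
qed

section \<open>Derivations as programs\<close>

lemma inj_on_code:
  assumes "effective_calculus \<P>" "A \<subseteq> lang \<P>"
  shows "inj_on (code \<P>) A"
proof -
  have "inj_on (encode \<P>) A"
    using assms inj_on_subset unfolding effective_calculus_def by blast
  then show ?thesis
    by (auto simp: inj_on_def code_def nat_of_string_inject)
qed

text \<open>Injectivity is required on \<open>A\<close> only, because \<open>code\<close> is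
  injective merely on well-formed formulas. It makes insertions of members of \<open>A\<close>
  commute, which is all that the fold needs.\<close>

lemma sorted_key_list_of_set_inj_on:
  fixes f :: "'a \<Rightarrow> 'b::linorder"
  assumes "finite A" "inj_on f A"
  shows "set (sorted_key_list_of_set f A) = A" "sorted (map f (sorted_key_list_of_set f A))"
    "distinct (sorted_key_list_of_set f A)"
proof -
  interpret folding_on A "insort_key f" "[]"
  proof
    show "insort_key f y \<circ> insort_key f x = insort_key f x \<circ> insort_key f y" if "x \<in> A" "y \<in> A" for x y
      using that assms(2) insort_key_left_comm[of f x y]
      by (cases "x = y") (auto simp: fun_eq_iff inj_on_eq_iff)
  qed
  have F: "sorted_key_list_of_set f = F"
    by (simp add: sorted_key_list_of_set_def)
  have "set (F B) = B \<and> sorted (map f (F B)) \<and> distinct (F B)" if "finite B" "B \<subseteq> A" for B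
    using that
    by (induction B) (simp_all add: set_insort_key sorted_insort_key distinct_insort)
  with assms(1) show "set (sorted_key_list_of_set f A) = A" "sorted (map f (sorted_key_list_of_set f A))"
    "distinct (sorted_key_list_of_set f A)"
    unfolding F by simp_all
qed

text \<open>The last fact expresses the base code through the set of formula codes alone, so that
  decoders can rebuild it by sorting numbers.\<close>

lemma
  assumes "effective_calculus \<P>" "finite B" "B \<subseteq> lang \<P>"
  shows set_base_list: "set (base_list \<P> B) = B"
    and length_base_list: "length (base_list \<P> B) = card B"
    and base_code_eq: "base_code \<P> B = list_encode (sorted_list_of_set (code \<P> ` B))"
proof -
  have inj: "inj_on (code \<P>) B"
    using inj_on_code assms by blast
  note L = sorted_key_list_of_set_inj_on[OF assms(2) inj, folded base_list_def]
  show "set (base_list \<P> B) = B" by (fact L)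
  then show "length (base_list \<P> B) = card B"
    using distinct_card[OF L(3)] by simp
  have "distinct (map (code \<P>) (base_list \<P> B))"
    using inj L by (simp add: distinct_map)
  from sorted_list_of_set.idem_if_sorted_distinct[OF L(2) this]
  show "base_code \<P> B = list_encode (sorted_list_of_set (code \<P> ` B))"
    by (simp add: base_code_def L(1))
qed

definition inference_codes :: "calculus \<Rightarrow> nat set" where
  "inference_codes \<P> = {prod_encode (r, prod_encode (list_encode (map (code \<P>) ps), code \<P> c)) | r ps c.
                  r \<in> rules \<P> \<and> infer \<P> r ps = Some c}"

text \<open>Injectivity of \<open>code\<close> on the language recovers the premises from their
  codes, so a search for \<open>k\<close> can return nothing but the conclusion.\<close>

lemma inference_codes_iff:
  assumes "effective_calculus \<P>" "r \<in> rules \<P>" "infer \<P> r ps = Some c"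
  shows "prod_encode (r, prod_encode (list_encode (map (code \<P>) ps), k)) \<in> inference_codes \<P> \<longleftrightarrow> k = code \<P> c"
proof
  have lang: "set ps \<subseteq> lang \<P>" if "infer \<P> r ps = Some c" for ps c
    using assms(1,2) that unfolding effective_calculus_def by blast
  assume "prod_encode (r, prod_encode (list_encode (map (code \<P>) ps), k)) \<in> inference_codes \<P>"
  then obtain ps' c' where ps': "map (code \<P>) ps = map (code \<P>) ps'" "infer \<P> r ps' = Some c'" "k = code \<P> c'"
    unfolding inference_codes_def by (auto simp: list_encode_eq)
  have "ps = ps'"
    using ps'(1) inj_on_code[OF assms(1), of "set ps \<union> set ps'"] lang[OF assms(3)] lang[OF ps'(2)]
    by (simp add: inj_on_map_eq_map)
  with ps' assms(3) show "k = code \<P> c" by simp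
qed (use assms in \<open>auto simp: inference_codes_def\<close>)

text \<open>
  A stack machine on a pool of formula codes and an argument stack: a digit \<open>d < R\<close> applies rule \<open>d\<close>
  to the stack, adds the conclusion to the pool and clears the stack; a digit \<open>R + i\<close> pushes the
  pool element of index \<open>i\<close>. Conclusions are added in front of the pool, so indices differ from those
  of the trace.
\<close>

definition derive_step :: "nat \<Rightarrow> nat set \<Rightarrow> nat \<Rightarrow> nat \<Rightarrow> nat option" where
  "derive_step R I d a =
     (let pool = fst (prod_decode a); args = snd (prod_decode a);
          P = (\<lambda>k. d < R \<and> prod_encode (d, prod_encode (args, k)) \<in> I \<or> \<not> d < R \<and> k = 0)
      in Option.bind (if \<exists>k. P k then Some (LEAST k. P k) else None)
        (\<lambda>k. Some (if d < R then prod_encode (list_encode (k # list_decode pool), 0)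
                   else prod_encode (pool, list_encode (lnth pool (d - R) # list_decode args)))))"

text \<open>One search covers both kinds of digits: a push digit succeeds at \<open>k = 0\<close>,
  while a rule digit diverges if the rule does not apply.\<close>

lemma partrec_derive_step:
  assumes "decidable I"
  shows "partrec (\<lambda>t. derive_step R I (fst (prod_decode t)) (snd (prod_decode t)))"
  unfolding derive_step_def Let_def
  by (intro partrec_bind partrec_search computable_partrec comp_intros assms)

lemma derive_step_infer:
  assumes "effective_calculus \<P>" "r \<in> rules \<P>" "infer \<P> r ps = Some c" "r < R"
  shows "derive_step R (inference_codes \<P>) r (prod_encode (list_encode xs, list_encode (map (code \<P>) ps)))
    = Some (prod_encode (list_encode (code \<P> c # xs), 0))"
proof -
  have "(LEAST k. k = code \<P> c) = code \<P> c" by (rule Least_equality) auto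
  with assms(4) show ?thesis
    by (simp add: derive_step_def Let_def inference_codes_iff[OF assms(1-3)] del: list_encode.simps)
qed

lemma derive_step_push:
  assumes "i < length xs"
  shows "derive_step R I (R + i) (prod_encode (list_encode xs, list_encode zs))
    = Some (prod_encode (list_encode xs, list_encode (xs ! i # zs)))"
  using assms by (simp add: derive_step_def Let_def lnth_list_encode del: list_encode.simps)

text \<open>The stack grows at its head, so \<open>zs\<close> is pushed from its last entry on. An
  index is looked up for each entry, whatever the order of the pool.\<close>

lemma foldM_derive_push:
  assumes "set zs \<subseteq> set xs"
  shows "\<exists>ds. length ds = length zs \<and> (\<forall>d\<in>set ds. d < R + length xs) \<and>
    foldM (derive_step R I) ds (prod_encode (list_encode xs, 0)) = Some (prod_encode (list_encode xs, list_encode zs))"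
  using assms
proof (induction zs)
  case Nil
  then show ?case by (intro exI[of _ "[]"]) simp
next
  case (Cons z zs)
  then obtain ds i where "length ds = length zs" "\<forall>d\<in>set ds. d < R + length xs"
    "foldM (derive_step R I) ds (prod_encode (list_encode xs, 0)) = Some (prod_encode (list_encode xs, list_encode zs))"
    "i < length xs" "xs ! i = z"
    by (auto simp: in_set_conv_nth)
  then show ?case
    by (intro exI[of _ "ds @ [R + i]"]) (simp add: foldM_append derive_step_push del: list_encode.simps)
qed

lemma length_replay: "replay \<P> pool steps = Some fin \<Longrightarrow> length fin = length pool + length steps"
  by (induction \<P> pool steps rule: replay.induct) (auto split: if_splits simp: bind_eq_Some_conv)

text \<open>Since pool orders differ, the invariant keeps only the set of codes and the length. A
  trace step costs at most \<open>a\<close> pushes and one rule digit.\<close>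

lemma foldM_derive_replay:
  assumes eff: "effective_calculus \<P>" and R: "\<forall>r\<in>rules \<P>. r < R"
    and arity: "\<forall>r\<in>rules \<P>. \<forall>ps. infer \<P> r ps \<noteq> None \<longrightarrow> length ps \<le> a"
    and "replay \<P> pool steps = Some fin" "set xs = code \<P> ` set pool" "length xs = length pool"
  shows "\<exists>ds xs'. foldM (derive_step R (inference_codes \<P>)) ds (prod_encode (list_encode xs, 0))
        = Some (prod_encode (list_encode xs', 0)) \<and>
      set xs' = code \<P> ` set fin \<and> length xs' = length fin \<and>
      length ds \<le> length steps * (a + 1) \<and> (\<forall>d\<in>set ds. d < R + length fin)"
  using assms(4-)
proof (induction steps arbitrary: pool xs)
  case Nil
  then show ?case
    by (intro exI[of _ "[]"] exI[of _ xs]) auto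
next
  case (Cons rj steps)
  obtain r js where rj: "rj = (r, js)" by (cases rj)
  with Cons.prems obtain c where r: "r \<in> rules \<P>" and js: "\<forall>j\<in>set js. j < length pool"
    and c: "infer \<P> r (map ((!) pool) js) = Some c" and rest: "replay \<P> (pool @ [c]) steps = Some fin"
    by (auto split: if_splits simp: bind_eq_Some_conv)
  let ?ps = "map ((!) pool) js"
  have "set (map (code \<P>) ?ps) \<subseteq> set xs"
    using js Cons.prems(2) by auto
  from foldM_derive_push[OF this, of R "inference_codes \<P>"] obtain ds1
    where ds1: "length ds1 = length js" "\<forall>d\<in>set ds1. d < R + length xs"
      "foldM (derive_step R (inference_codes \<P>)) ds1 (prod_encode (list_encode xs, 0))
        = Some (prod_encode (list_encode xs, list_encode (map (code \<P>) ?ps)))"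
    by auto
  have "set (code \<P> c # xs) = code \<P> ` set (pool @ [c])" "length (code \<P> c # xs) = length (pool @ [c])"
    using Cons.prems by simp_all
  from Cons.IH[OF rest this] obtain ds2 xs' where ds2:
    "foldM (derive_step R (inference_codes \<P>)) ds2 (prod_encode (list_encode (code \<P> c # xs), 0))
        = Some (prod_encode (list_encode xs', 0))"
    "set xs' = code \<P> ` set fin" "length xs' = length fin"
    "length ds2 \<le> length steps * (a + 1)" "\<forall>d\<in>set ds2. d < R + length fin"
    by blast
  have "length xs \<le> length fin"
    using length_replay[OF rest] Cons.prems(3) by simp
  then have "\<forall>d\<in>set (ds1 @ r # ds2). d < R + length fin"
    using ds1(2) ds2(5) R r by fastforce
  moreover have "length js \<le> a" using arity r c by force
  then have "length (ds1 @ r # ds2) \<le> length (rj # steps) * (a + 1)"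
    using ds1(1) ds2(4) by simp
  moreover have "foldM (derive_step R (inference_codes \<P>)) (ds1 @ r # ds2) (prod_encode (list_encode xs, 0))
      = Some (prod_encode (list_encode xs', 0))"
    using R r by (simp add: foldM_append ds1(3) derive_step_infer[OF eff r c] ds2(1) del: list_encode.simps map_map)
  ultimately show ?case using ds2(2,3) by blast
qed

text \<open>The last digit of a program pushes the derived formula, so the output is the head of the
  argument stack; this is the extra digit in the length bound below.\<close>

definition run_derivation :: "nat \<Rightarrow> nat set \<Rightarrow> nat \<Rightarrow> nat option" where
  "run_derivation R I t = Option.bind
     (foldM (derive_step R I) (list_decode (fst (prod_decode t))) (prod_encode (snd (prod_decode t), 0)))
     (\<lambda>a. Some (lhd (snd (prod_decode a))))"

lemma partrec_run_derivation:
  assumes "decidable I"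
  shows "partrec (run_derivation R I)"
proof -
  have "computable (\<lambda>t. prod_encode (fst (prod_decode t), prod_encode (snd (prod_decode t), 0)))"
    by (intro comp_intros)
  from partrec_comp_computable[OF partrec_foldM[OF partrec_derive_step[OF assms]] this]
  have "partrec (\<lambda>t. foldM (derive_step R I) (list_decode (fst (prod_decode t))) (prod_encode (snd (prod_decode t), 0)))"
    by simp
  then have "partrec (\<lambda>t. run_derivation R I t)"
    unfolding run_derivation_def by (intro partrec_bind computable_partrec comp_intros)
  then show ?thesis by simp
qed

lemma run_derivation_trace:
  assumes eff: "effective_calculus \<P>" and R: "\<forall>r\<in>rules \<P>. r < R"
    and arity: "\<forall>r\<in>rules \<P>. \<forall>ps. infer \<P> r ps \<noteq> None \<longrightarrow> length ps \<le> a"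
    and B: "finite B" "B \<subseteq> lang \<P>" and trace: "is_trace \<P> B q (steps, out)"
  shows "\<exists>ds. run_derivation R (inference_codes \<P>) (prod_encode (list_encode ds, base_code \<P> B)) = Some (code \<P> q) \<and>
     length ds \<le> length steps * (a + 1) + 1 \<and> (\<forall>d\<in>set ds. d < R + card B + length steps)"
proof -
  from trace obtain fin where fin: "replay \<P> (base_list \<P> B) steps = Some fin" "out < length fin" "fin ! out = q"
    by (auto simp: is_trace_def)
  have len: "length fin = card B + length steps"
    using length_replay[OF fin(1)] length_base_list[OF eff B] by simp
  from foldM_derive_replay[OF eff R arity fin(1), of "map (code \<P>) (base_list \<P> B)"]
  obtain ds xs where ds: "foldM (derive_step R (inference_codes \<P>)) ds (prod_encode (base_code \<P> B, 0))
        = Some (prod_encode (list_encode xs, 0))"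
      "set xs = code \<P> ` set fin" "length xs = length fin" "length ds \<le> length steps * (a + 1)"
      "\<forall>d\<in>set ds. d < R + length fin"
    by (auto simp: base_code_def)
  have "code \<P> q \<in> set xs" using ds(2) fin(2,3) by auto
  then obtain i where i: "i < length xs" "xs ! i = code \<P> q" by (auto simp: in_set_conv_nth)
  have "run_derivation R (inference_codes \<P>) (prod_encode (list_encode (ds @ [R + i]), base_code \<P> B)) = Some (code \<P> q)"
    using i derive_step_push[OF i(1), of R "inference_codes \<P>" "[]"]
    using lhd_Cons[of "code \<P> q" "[]"] by (simp add: run_derivation_def foldM_append ds(1))
  moreover have "\<forall>d\<in>set (ds @ [R + i]). d < R + card B + length steps"
    using ds(3,5) i len by auto
  ultimately show ?thesis using ds(4) by (intro exI[of _ "ds @ [R + i]"]) simp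
qed

section \<open>Trace length as an upper bound for complexity\<close>

lemma Ntr_witness:
  assumes "Ntr \<P> B q = enat n"
  obtains steps out where "is_trace \<P> B q (steps, out)" "length steps = n"
proof -
  let ?A = "{enat (length (fst \<pi>)) | \<pi>. is_trace \<P> B q \<pi>}"
  have "?A \<noteq> {}" using assms unfolding Ntr_def by (auto simp: Inf_enat_def split: if_splits)
  then have "Inf ?A \<in> ?A"
    unfolding Inf_enat_def by (simp only: if_False) (rule LeastI_ex, blast)
  then show ?thesis using that assms unfolding Ntr_def by auto
qed

lemma exponent_bound:
  assumes "2 \<le> x"
  shows "\<exists>b\<ge>1. x \<le> 2 ^ b \<and> real b \<le> log 2 (real x) + 1"
proof -
  define b where "b = nat \<lceil>log 2 (real x)\<rceil>"
  have 1: "1 \<le> log 2 (real x)" using assms by simp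
  then have b: "log 2 (real x) \<le> real b" "real b \<le> log 2 (real x) + 1" "1 \<le> b"
    unfolding b_def by linarith+
  have "real x \<le> 2 powr real b"
    using b(1) assms by (simp add: log_le_iff)
  then have "real x \<le> real (2 ^ b)" by (simp add: powr_realpow)
  then have "x \<le> 2 ^ b" by (simp only: of_nat_le_iff)
  with b show ?thesis by blast
qed

text \<open>Since \<open>B\<close> is nonempty and \<open>n \<ge> 1\<close>, both \<open>n\<close>
  and log (m + n) are at least 1, and so all additive constants can be turned into factors.\<close>

lemma Kolm_le_Ntr:
  assumes eff: "effective_calculus \<P>" and U: "universal_prefix_machine U"
  obtains C where "C > 0" "\<And>B q n. finite B \<Longrightarrow> B \<subseteq> lang \<P> \<Longrightarrow> B \<noteq> {} \<Longrightarrow> 1 \<le> n \<Longrightarrow> Ntr \<P> B q = enat n \<Longrightarrow>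
     real (Kolm U (code \<P> q) (base_code \<P> B)) \<le> C * real n * log 2 (real (card B + n))"
proof -
  from eff obtain a where a: "\<forall>r\<in>rules \<P>. \<forall>ps. infer \<P> r ps \<noteq> None \<longrightarrow> length ps \<le> a"
    and fin: "finite (rules \<P>)" and I: "decidable (inference_codes \<P>)"
    unfolding effective_calculus_def inference_codes_def by blast
  from fin obtain R where R: "\<forall>r\<in>rules \<P>. r < R"
    by (auto simp: finite_nat_set_iff_bounded)
  obtain c0 where c0: "\<And>y. \<exists>p. U p y = Some y \<and> length p \<le> c0"
    using universal_constant[OF U computable_id] by blast
  obtain c1 where c1: "\<And>ds b y y' p x. 1 \<le> b \<Longrightarrow> \<forall>d\<in>set ds. Suc d < 2 ^ b \<Longrightarrow>
     run_derivation R (inference_codes \<P>) (prod_encode (list_encode ds, y)) = Some y' \<Longrightarrow> U p y' = Some x \<Longrightarrow>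
     \<exists>p'. U p' y = Some x \<and> length p' \<le> length p + 4 * b * (length ds + 2) + c1"
    using universal_digits[OF U partrec_run_derivation[OF I]] by blast
  \<comment> \<open>Digits lie below (R + 2) (m + n), so \<open>l\<close> bounds their width in
    units of log (m + n), rounding included. The \<open>a + 4\<close> in \<open>C\<close> comes from
    n (a + 1) + 3 \<le> n (a + 4).\<close>
  define l where "l = log 2 (real (R + 2)) + 2"
  define C where "C = real (c0 + c1) + 4 * l * real (a + 4)"
  have l: "l \<ge> 2" by (simp add: l_def)
  show ?thesis
  proof (rule that)
    show "C > 0" using l by (simp add: C_def add_nonneg_pos)
    fix B q n
    assume B: "finite B" "B \<subseteq> lang \<P>" "B \<noteq> {}" and n: "1 \<le> n" "Ntr \<P> B q = enat n"
    let ?M = "card B + n" and ?K = "Kolm U (code \<P> q) (base_code \<P> B)"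
    have M: "2 \<le> ?M" using n(1) card_gt_0_iff[of B] B by linarith
    obtain steps out where "is_trace \<P> B q (steps, out)" "length steps = n"
      using Ntr_witness[OF n(2)] .
    with run_derivation_trace[OF eff R a B(1,2)] obtain ds where ds:
      "run_derivation R (inference_codes \<P>) (prod_encode (list_encode ds, base_code \<P> B)) = Some (code \<P> q)"
      "length ds \<le> n * (a + 1) + 1" "\<forall>d\<in>set ds. d < R + card B + n"
      by blast
    have "2 \<le> (R + 2) * ?M" using M by simp
    from exponent_bound[OF this] obtain b where b: "1 \<le> b" "(R + 2) * ?M \<le> 2 ^ b"
      "real b \<le> log 2 (real ((R + 2) * ?M)) + 1" by blast
    have "x + y + 1 \<le> (x + 2) * y" if "2 \<le> y" for x y :: nat
      using that by (induction x) auto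
    from this[OF M, of R] have "R + ?M + 1 \<le> (R + 2) * ?M" .
    then have digits: "\<forall>d\<in>set ds. Suc d < 2 ^ b"
      using b(2) ds(3) by (auto simp del: One_nat_def dest!: bspec)
    \<comment> \<open>The header already produces the code of \<open>q\<close> as the new condition,
      so the rest of the program only has to print it.\<close>
    obtain p where p: "U p (code \<P> q) = Some (code \<P> q)" "length p \<le> c0" using c0 by blast
    from c1[OF b(1) digits ds(1) p(1)] obtain p' where p': "U p' (base_code \<P> B) = Some (code \<P> q)"
      "length p' \<le> length p + 4 * b * (length ds + 2) + c1" by blast
    have "length ds + 2 \<le> n * (a + 4)" using ds(2) n(1) by (simp add: algebra_simps)
    then have "4 * b * (length ds + 2) \<le> 4 * b * (n * (a + 4))" by (rule mult_le_mono2)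
    then have "?K \<le> c0 + c1 + 4 * b * (n * (a + 4))"
      using Kolm_le[of U, OF p'(1)] p'(2) p(2) by linarith
    then have "real ?K \<le> real (c0 + c1 + 4 * b * (n * (a + 4)))"
      by (simp only: of_nat_le_iff)
    then have K: "real ?K \<le> real (c0 + c1) + 4 * real b * (real n * real (a + 4))"
      by (simp only: of_nat_add of_nat_mult of_nat_numeral)
    have L: "1 \<le> log 2 (real ?M)" using M by simp
    have "log 2 (real ((R + 2) * ?M)) = log 2 (real (R + 2)) + log 2 (real ?M)"
      using M by (simp only: of_nat_mult) (simp add: log_mult)
    then have "real b \<le> (l - 2) + 1 + log 2 (real ?M)" using b(3) by (simp add: l_def)
    also have "\<dots> \<le> l * log 2 (real ?M)"
    proof -
      have "(l - 1) * 1 \<le> (l - 1) * log 2 (real ?M)" using l L by (intro mult_left_mono) auto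
      then show ?thesis by (simp add: algebra_simps)
    qed
    finally have "4 * real b * (real n * real (a + 4)) \<le> 4 * (l * log 2 (real ?M)) * (real n * real (a + 4))"
      by (intro mult_right_mono) auto
    moreover have "real (c0 + c1) * 1 \<le> real (c0 + c1) * (real n * log 2 (real ?M))"
      using n(1) L by (intro mult_left_mono) (auto intro: mult_ge1_I)
    ultimately show "real ?K \<le> C * real n * log 2 (real ?M)"
      using K by (simp add: C_def algebra_simps)
  qed
qed

section \<open>Recovering the clean base from the noisy one\<close>

text \<open>A digit \<open>Suc j\<close> pushes \<open>j\<close> on the first of two lists, and \<open>0\<close> exchanges the lists.\<close>

definition index_step :: "nat \<Rightarrow> nat \<Rightarrow> nat option" where
  "index_step d a = Some (if d = 0 then prod_encode (snd (prod_decode a), fst (prod_decode a))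
     else prod_encode (list_encode ((d - 1) # list_decode (fst (prod_decode a))), snd (prod_decode a)))"

lemma foldM_index_push:
  "foldM index_step (map Suc (rev J)) (prod_encode (list_encode A, b)) = Some (prod_encode (list_encode (J @ A), b))"
  by (induction J arbitrary: A) (simp_all add: foldM_append index_step_def del: list_encode.simps)

lemma foldM_index_lists:
  "foldM index_step (map Suc (rev J') @ 0 # map Suc (rev J)) (prod_encode (0, 0))
     = Some (prod_encode (list_encode J, list_encode J'))"
proof -
  have "foldM index_step (map Suc (rev J')) (prod_encode (0, 0)) = Some (prod_encode (list_encode J', 0))"
    using foldM_index_push[of J' "[]" 0] by simp
  moreover have "index_step 0 (prod_encode (list_encode J', 0)) = Some (prod_encode (0, list_encode J'))"
    by (simp add: index_step_def)
  moreover have "foldM index_step (map Suc (rev J)) (prod_encode (0, list_encode J')) = Some (prod_encode (list_encode J, list_encode J'))"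
    using foldM_index_push[of J "[]" "list_encode J'"] by simp
  ultimately show ?thesis by (simp add: foldM_append)
qed

text \<open>On codes: remove the added premises, then put back the lost ones. The argument
  \<open>r\<close> pairs the lost with the added part, and the bound is justified by
  \<open>mem_less_list_encode\<close>.\<close>

definition undo_noise :: "nat \<Rightarrow> nat \<Rightarrow> nat" where
  "undo_noise y r = list_encode (sorted_list_of_set {x. x < y + fst (prod_decode r) \<and>
     (x \<in> set (list_decode y) \<and> x \<notin> set (list_decode (snd (prod_decode r))) \<or>
      x \<in> set (list_decode (fst (prod_decode r))))})"

lemma computable_undo_noise [comp_intros]:
  assumes "computable f" "computable g"
  shows "computable (\<lambda>n. undo_noise (f n) (g n))"
  unfolding undo_noise_def
  by (intro computable_sorted_list comp_intros assms computable_comp[OF assms(1) computable_fst]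
      computable_comp[OF assms(2) computable_fst])

lemma undo_noise_base_code:
  assumes eff: "effective_calculus \<P>" and "S \<subseteq> lang \<P>" "premise_base S B"
    and "Bm \<subseteq> B" "finite Bp" "Bp \<subseteq> S - B"
  shows "undo_noise (base_code \<P> (noisy_base B Bm Bp)) (prod_encode (base_code \<P> Bm, base_code \<P> Bp))
    = base_code \<P> B"
proof -
  have sub: "B \<subseteq> lang \<P>" "Bm \<subseteq> lang \<P>" "Bp \<subseteq> lang \<P>" "noisy_base B Bm Bp \<subseteq> lang \<P>"
    using assms by (auto simp: premise_base_def noisy_base_def)
  have fin: "finite B" "finite Bm" "finite (noisy_base B Bm Bp)"
    using assms by (auto simp: premise_base_def noisy_base_def intro: finite_subset)
  have dec: "set (list_decode (base_code \<P> A)) = code \<P> ` A" if "finite A" "A \<subseteq> lang \<P>" for A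
    using base_code_eq[OF eff that] that by simp
  have bound: "code \<P> a < base_code \<P> A" if "finite A" "A \<subseteq> lang \<P>" "a \<in> A" for a A
    using mem_less_list_encode[of "code \<P> a" "list_decode (base_code \<P> A)"] dec[OF that(1,2)] that(3) by simp
  have inj: "code \<P> a = code \<P> a' \<longleftrightarrow> a = a'" if "a \<in> lang \<P>" "a' \<in> lang \<P>" for a a'
    using inj_on_eq_iff[OF inj_on_code[OF eff order_refl] that] .
  let ?Bt = "noisy_base B Bm Bp"
  \<comment> \<open>Removing all of \<open>Bp\<close> is harmless because it is disjoint from
    \<open>B\<close>, and restoring \<open>Bm\<close> adds nothing foreign because it is contained
    in \<open>B\<close>.\<close>
  have B: "B = (?Bt - Bp) \<union> Bm"
    using assms(4,6) by (auto simp: noisy_base_def)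
  have "code \<P> ` B = code \<P> ` (?Bt - Bp) \<union> code \<P> ` Bm"
    by (subst B) (rule image_Un)
  also have "code \<P> ` (?Bt - Bp) = code \<P> ` ?Bt - code \<P> ` Bp"
    using inj_on_image_set_diff[OF inj_on_code[OF eff order_refl], of ?Bt Bp] sub by blast
  finally have image: "code \<P> ` B = code \<P> ` ?Bt - code \<P> ` Bp \<union> code \<P> ` Bm" .
  have "{x. x < base_code \<P> ?Bt + base_code \<P> Bm \<and>
      (x \<in> code \<P> ` ?Bt \<and> x \<notin> code \<P> ` Bp \<or> x \<in> code \<P> ` Bm)} = code \<P> ` B"
    unfolding image using bound[OF fin(3) sub(4)] bound[OF fin(2) sub(2)] by (auto intro: trans_less_add1 trans_less_add2)
  then show ?thesis
    unfolding undo_noise_def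
    by (simp add: dec fin sub assms(5) base_code_eq[OF eff fin(1) sub(1)])
qed

definition restore_base :: "(nat \<Rightarrow> nat option) \<Rightarrow> nat \<Rightarrow> nat option" where
  "restore_base D t = Option.bind (foldM index_step (list_decode (fst (prod_decode t))) (prod_encode (0, 0)))
     (\<lambda>J. Option.bind (D (prod_encode (J, snd (prod_decode t))))
       (\<lambda>r. Some (undo_noise (snd (prod_decode t)) r)))"

lemma partrec_restore_base:
  assumes "partrec D"
  shows "partrec (restore_base D)"
proof -
  have "partrec (\<lambda>t. index_step (fst (prod_decode t)) (snd (prod_decode t)))"
    unfolding index_step_def by (intro computable_partrec comp_intros)
  moreover have "computable (\<lambda>t. prod_encode (fst (prod_decode t), prod_encode (0, 0)))"
    by (intro comp_intros)
  ultimately have "partrec (\<lambda>t. foldM index_step (list_decode (fst (prod_decode t))) (prod_encode (0, 0)))"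
    using partrec_comp_computable[OF partrec_foldM] by fastforce
  then have "partrec (\<lambda>t. restore_base D t)"
    unfolding restore_base_def
    by (intro partrec_bind partrec_comp_computable[OF assms] computable_partrec comp_intros)
  then show ?thesis by simp
qed

text \<open>A pure power turns the logarithm of the vocabulary size into a multiple of log x. The
  margin 3 leaves room for the shift of the digits.\<close>

lemma poly_nat_le_power: "\<exists>k. \<forall>x\<ge>2. poly p x + 3 \<le> (x :: nat) ^ k"
proof (induction p)
  case 0
  have "3 \<le> x ^ 2" if "2 \<le> x" for x :: nat
    using power_mono[OF that, of 2] by simp
  then show ?case by auto
next
  case (pCons a p)
  then obtain k where k: "\<And>x. 2 \<le> x \<Longrightarrow> poly p x + 3 \<le> x ^ k" by blast
  have "poly (pCons a p) x + 3 \<le> x ^ (k + a + 2)" if x: "2 \<le> x" for x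
  proof -
    have "x * (poly p x + 3) \<le> x * x ^ k" using k[OF x] by (rule mult_le_mono2)
    then have "a + x * poly p x + 3 \<le> a + x * x ^ k" using x by (simp add: add_mult_distrib2)
    moreover have "a \<le> x ^ a"
      using less_exp[of a] power_mono[OF x, of a] by linarith
    moreover have "x ^ a \<le> x ^ (k + a + 1)" "x * x ^ k \<le> x ^ (k + a + 1)"
      using x by (auto intro: power_increasing simp flip: power_Suc)
    moreover have "2 * x ^ (k + a + 1) \<le> x * x ^ (k + a + 1)"
      using x by (rule mult_le_mono1)
    ultimately have "a + x * poly p x + 3 \<le> x * x ^ (k + a + 1)" by linarith
    then show ?thesis by simp
  qed
  then show ?case by blast
qed

text \<open>The header lists N indices and a separator; an index lies below a polynomial in m + N
  and takes O(log (m + N)) bits. The assumption \<open>N \<ge> 1\<close> absorbs the separator and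
  the machine constant.\<close>

lemma Kolm_noisy_base_le:
  assumes eff: "effective_calculus \<P>" and S: "S \<subseteq> lang \<P>" and U: "universal_prefix_machine U"
    and base: "\<And>i. premise_base S (B i)" "\<And>i. B i \<noteq> {}"
    and noise: "\<And>i. Bm i \<subseteq> B i" "\<And>i. finite (Bp i)" "\<And>i. Bp i \<subseteq> S - B i"
    and descr: "describable_noise \<P> S pb B Bm Bp"
  obtains C where "C > 0" "\<And>i x. 1 \<le> card (Bm i) + card (Bp i) \<Longrightarrow>
     real (Kolm U x (base_code \<P> (noisy_base (B i) (Bm i) (Bp i))))
       \<le> real (Kolm U x (base_code \<P> (B i)))
        + C * real (card (Bm i) + card (Bp i)) * log 2 (real (card (B i) + (card (Bm i) + card (Bp i))))"
proof -
  define N where "N i = card (Bm i) + card (Bp i)" for i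
  from descr obtain V D where V: "\<And>s. distinct (V s)" "\<And>s. length (V s) \<le> poly pb s"
    and D: "partrec D"
    and J: "\<And>i. \<exists>Jm Jp. distinct Jm \<and> distinct Jp \<and> (\<forall>j\<in>set Jm \<union> set Jp. j < length (V (card (B i) + N i))) \<and>
              (!) (V (card (B i) + N i)) ` set Jm = Bm i \<and> (!) (V (card (B i) + N i)) ` set Jp = Bp i \<and>
              D (prod_encode (prod_encode (list_encode Jm, list_encode Jp), base_code \<P> (noisy_base (B i) (Bm i) (Bp i))))
                       = Some (prod_encode (base_code \<P> (Bm i), base_code \<P> (Bp i)))"
    unfolding describable_noise_def Let_def N_def by metis
  obtain k where k: "\<And>x. 2 \<le> x \<Longrightarrow> poly pb x + 3 \<le> x ^ k"
    using poly_nat_le_power by blast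
  obtain c where c: "\<And>ds b y y' p x. 1 \<le> b \<Longrightarrow> \<forall>d\<in>set ds. Suc d < 2 ^ b \<Longrightarrow>
     restore_base D (prod_encode (list_encode ds, y)) = Some y' \<Longrightarrow> U p y' = Some x \<Longrightarrow>
     \<exists>p'. U p' y = Some x \<and> length p' \<le> length p + 4 * b * (length ds + 2) + c"
    using universal_digits[OF U partrec_restore_base[OF D]] by blast
  \<comment> \<open>16 is the factor 4 of \<open>universal_digits\<close> times the 4 in N + 3 \<le>
    4 N; \<open>k + 1\<close> bounds the digit width in units of log (m + N).\<close>
  define C where "C = 16 * (real k + 1) + real c"
  show ?thesis
  proof (rule that[of C, folded N_def])
    show "C > 0" by (simp add: C_def add_pos_nonneg)
    fix i x
    assume N: "1 \<le> N i"
    let ?M = "card (B i) + N i" and ?Bt = "noisy_base (B i) (Bm i) (Bp i)"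
    let ?W = "V ?M"
    have "0 < card (B i)" using base by (simp add: card_gt_0_iff premise_base_def)
    with N have M: "2 \<le> ?M" by linarith
    obtain Jm Jp where Jd: "distinct Jm" "distinct Jp" and Jl: "\<forall>j\<in>set Jm \<union> set Jp. j < length ?W"
      and JB: "(!) ?W ` set Jm = Bm i" "(!) ?W ` set Jp = Bp i"
      and JD: "D (prod_encode (prod_encode (list_encode Jm, list_encode Jp), base_code \<P> ?Bt))
                 = Some (prod_encode (base_code \<P> (Bm i), base_code \<P> (Bp i)))"
      using J[of i] by blast
    \<comment> \<open>Converts the number of digits into \<open>N i\<close>: neither the index lists
      nor the vocabulary have repetitions.\<close>
    have card: "length J = card ((!) ?W ` set J)" if "distinct J" "set J \<subseteq> {..<length ?W}" for J
    proof -
      have "inj_on ((!) ?W) (set J)"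
        using inj_on_nth[OF V(1)[of ?M], of "set J"] that(2) by auto
      then show ?thesis using that(1) by (simp add: card_image distinct_card)
    qed
    have "length Jm = card (Bm i)" "length Jp = card (Bp i)"
      using card[OF Jd(1)] card[OF Jd(2)] Jl JB by auto
    then have len: "length Jm + length Jp = N i" by (simp add: N_def)
    let ?ds = "map Suc (rev Jp) @ 0 # map Suc (rev Jm)"
    have run: "restore_base D (prod_encode (list_encode ?ds, base_code \<P> ?Bt)) = Some (base_code \<P> (B i))"
      using JD undo_noise_base_code[OF eff S base(1) noise]
      by (simp add: restore_base_def foldM_index_lists del: foldM.simps)
    have "2 \<le> ?M ^ k" using k[OF M] by linarith
    from exponent_bound[OF this] obtain b where b: "1 \<le> b" "?M ^ k \<le> 2 ^ b"
      "real b \<le> log 2 (real (?M ^ k)) + 1" by blast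
    have "length ?W + 3 \<le> 2 ^ b" using V(2)[of ?M] k[OF M] b(2) by linarith
    moreover have "\<forall>d\<in>set ?ds. d \<le> length ?W"
      using Jl by (auto simp: Suc_le_eq)
    ultimately have digits: "\<forall>d\<in>set ?ds. Suc d < 2 ^ b"
    proof (intro ballI)
      show "Suc d < 2 ^ b" if "d \<in> set ?ds" "\<forall>d\<in>set ?ds. d \<le> length ?W" "length ?W + 3 \<le> 2 ^ b" for d
        using bspec[OF that(2,1)] that(3) by linarith
    qed
    obtain p where p: "U p (base_code \<P> (B i)) = Some x" "length p = Kolm U x (base_code \<P> (B i))"
      using Kolm_witness[OF U] by blast
    from c[OF b(1) digits run p(1)] obtain p' where p': "U p' (base_code \<P> ?Bt) = Some x"
      "length p' \<le> length p + 4 * b * (length ?ds + 2) + c" by blast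
    have "length ?ds + 2 \<le> 4 * N i" using len N by simp
    then have "4 * b * (length ?ds + 2) \<le> 4 * b * (4 * N i)" by (rule mult_le_mono2)
    then have "Kolm U x (base_code \<P> ?Bt) \<le> Kolm U x (base_code \<P> (B i)) + 16 * b * N i + c"
      using Kolm_le[of U, OF p'(1)] p'(2) p(2) by linarith
    then have "real (Kolm U x (base_code \<P> ?Bt)) \<le> real (Kolm U x (base_code \<P> (B i)) + 16 * b * N i + c)"
      by (simp only: of_nat_le_iff)
    then have K: "real (Kolm U x (base_code \<P> ?Bt)) \<le> real (Kolm U x (base_code \<P> (B i))) + 16 * real b * real (N i) + real c"
      by (simp only: of_nat_add of_nat_mult of_nat_numeral)
    have L: "1 \<le> log 2 (real ?M)" using M by simp
    have "log 2 (real (?M ^ k)) = real k * log 2 (real ?M)"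
      using M by (simp only: of_nat_power) (simp add: log_nat_power)
    then have "real b \<le> (real k + 1) * log 2 (real ?M)"
      using b(3) L by (simp add: algebra_simps)
    then have "16 * real b * real (N i) \<le> 16 * ((real k + 1) * log 2 (real ?M)) * real (N i)"
      by (intro mult_right_mono) auto
    moreover have "real c * 1 \<le> real c * (real (N i) * log 2 (real ?M))"
      using N L by (intro mult_left_mono) (auto intro: mult_ge1_I)
    ultimately show "real (Kolm U x (base_code \<P> ?Bt))
       \<le> real (Kolm U x (base_code \<P> (B i))) + C * real (N i) * log 2 (real ?M)"
      using K by (simp add: C_def algebra_simps)
  qed
qed

section \<open>Depth under noise\<close>

lemma Dd_eq:
  assumes "premise_structure \<P> S PO" "s \<in> S"
  shows "Dd S PO B s = (if s \<in> B then 0 else Suc (Max (insert 0 (Dd S PO B ` PO s))))"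
proof -
  let ?R = "{(s', s). s \<in> S \<and> s' \<in> PO s}"
  have "wf ?R" using assms(1) by (simp add: premise_structure_def)
  \<comment> \<open>The recursion consults its argument only on \<open>PO s\<close>, where the cut
    changes nothing.\<close>
  moreover have "cut f ?R s ` PO s = f ` PO s" for f :: "fml \<Rightarrow> nat"
    using assms(2) by (auto simp: cut_def image_iff)
  ultimately show ?thesis
    unfolding Dd_def by (subst wfrec) simp_all
qed

text \<open>The recursion under \<open>B'\<close> can outlast the one under \<open>B\<close> only
  past a formula of \<open>B\<close> missing from \<open>B'\<close>, and there by at most
  \<open>k\<close> levels. Depth is a maximum over branches, so these excesses do not add
  up.\<close>

lemma Dd_le_add:
  assumes P: "premise_structure \<P> S PO"
    and k: "\<And>b. b \<in> S \<Longrightarrow> b \<in> B \<Longrightarrow> b \<notin> B' \<Longrightarrow> Dd S PO B' b \<le> k"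
    and "s \<in> S"
  shows "Dd S PO B' s \<le> Dd S PO B s + k"
proof -
  have "wf {(s', s). s \<in> S \<and> s' \<in> PO s}" using P by (simp add: premise_structure_def)
  then show ?thesis
    using \<open>s \<in> S\<close>
  proof (induction s rule: wf_induct_rule)
    case (less s)
    show ?case
    proof (cases "s \<in> B \<or> s \<in> B'")
      case True
      then show ?thesis
        using k[OF less.prems] Dd_eq[OF P less.prems, of B'] by (auto intro: trans_le_add2)
    next
      case False
      have PO: "finite (PO s)" "PO s \<subseteq> S"
        using P less.prems by (auto simp: premise_structure_def)
      have "d \<le> Max (insert 0 (Dd S PO B ` PO s)) + k" if "d \<in> insert 0 (Dd S PO B' ` PO s)" for d
      proof (cases "d = 0")
        case False
        with that obtain t where t: "t \<in> PO s" "d = Dd S PO B' t" by auto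
        then have "d \<le> Dd S PO B t + k" using less.IH[of t] less.prems PO(2) by auto
        moreover have "Dd S PO B t \<le> Max (insert 0 (Dd S PO B ` PO s))"
          using PO(1) t(1) by (intro Max_ge) auto
        ultimately show ?thesis by linarith
      qed simp
      then have "Max (insert 0 (Dd S PO B' ` PO s)) \<le> Max (insert 0 (Dd S PO B ` PO s)) + k"
        using PO(1) by (intro Max.boundedI) auto
      then show ?thesis using False by (simp add: Dd_eq[OF P less.prems])
    qed
  qed
qed

text \<open>\<open>Dd_le_add\<close> is used twice: with \<open>k = 0\<close> it shows that a larger
  base only shortens the recursion, which bounds the noisy depth of a lost premise by
  \<open>d\<close>; this bound is the \<open>k\<close> of the other use.\<close>

lemma Dd_noisy_le:
  assumes P: "premise_structure \<P> S PO" and "finite B" "Bm \<subseteq> B" "s \<in> S"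
    and d: "rec_depth \<P> S PO B Bm = enat d"
  shows "Dd S PO (noisy_base B Bm Bp) s \<le> Dd S PO B s + d"
proof (rule Dd_le_add[OF P _ \<open>s \<in> S\<close>])
  fix b assume b: "b \<in> S" "b \<in> B" "b \<notin> noisy_base B Bm Bp"
  then have "b \<in> Bm" by (auto simp: noisy_base_def)
  have "Dd S PO (noisy_base B Bm Bp) b \<le> Dd S PO (B - Bm) b + 0"
    by (rule Dd_le_add[OF P _ b(1)]) (auto simp: noisy_base_def)
  also have "\<dots> \<le> Max (insert 0 (Dd S PO (B - Bm) ` Bm))"
    using \<open>b \<in> Bm\<close> assms(2,3) by (auto intro!: Max_ge intro: finite_subset)
  also have "\<dots> = d" using d by (auto simp: rec_depth_def split: if_splits)
  finally show "Dd S PO (noisy_base B Bm Bp) b \<le> d" .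
qed

section \<open>Costs and critical frequency\<close>

text \<open>A factor inside the logarithm is an additive constant outside, and log (m + x) \<ge> 1
  turns it into a factor again.\<close>

lemma log_add_le_mult_log:
  assumes "1 \<le> m" "1 \<le> x" "real y \<le> c * real x"
  shows "log 2 (real (m + y)) \<le> (1 + log 2 (max 1 c)) * log 2 (real (m + x))"
proof -
  have "real m \<le> max 1 c * real m" using assms(1) by (simp add: mult_le_cancel_right1)
  moreover have "c * real x \<le> max 1 c * real x" by (intro mult_right_mono) auto
  ultimately have "real (m + y) \<le> max 1 c * real (m + x)"
    using assms(3) by (simp add: algebra_simps)
  then have "log 2 (real (m + y)) \<le> log 2 (max 1 c * real (m + x))"
    using assms(1) by simp
  also have "\<dots> = log 2 (max 1 c) + log 2 (real (m + x))"
    using assms(1) by (subst log_mult) auto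
  also have "log 2 (max 1 c) \<le> log 2 (max 1 c) * log 2 (real (m + x))"
  proof -
    have "1 \<le> log 2 (real (m + x))" using assms(1,2) by simp
    moreover have "0 \<le> log 2 (max 1 c)" by simp
    ultimately show ?thesis by (simp add: mult_le_cancel_left1)
  qed
  finally show ?thesis by (simp add: algebra_simps)
qed

text \<open>Serializability makes \<open>n\<close> and \<open>n'\<close> comparable;
  \<open>log_add_le_mult_log\<close>, applied in both directions, does the same for the
  logarithms.\<close>

lemma Theta_depth_le:
  fixes m n n' k :: nat
  assumes "1 \<le> m" "1 \<le> n" "0 < a" "a * real n \<le> real n'" "real n' \<le> b * real n"
  shows "a / (1 + log 2 (max 1 (1 / a))) * (real n * log 2 (real (m + n))) \<le> real n' * log 2 (real (m + n'))"
    and "real n' * log 2 (real (m + n')) \<le> b * (1 + log 2 (max 1 b)) * (real n * log 2 (real (m + n)))"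
proof -
  have "0 < a * real n" using assms(2,3) by simp
  with assms(4) have n': "1 \<le> n'" by (cases n') auto
  define e where "e = 1 + log 2 (max 1 (1 / a))"
  have e: "1 \<le> e" by (simp add: e_def)
  have "log 2 (real (m + n)) \<le> e * log 2 (real (m + n'))"
    unfolding e_def using assms n' by (intro log_add_le_mult_log) (auto simp: field_simps)
  then have "log 2 (real (m + n)) / e \<le> log 2 (real (m + n'))"
    using e by (simp add: field_simps)
  with assms(1-4) e have "(a * real n) * (log 2 (real (m + n)) / e) \<le> real n' * log 2 (real (m + n'))"
    by (intro mult_mono) auto
  then show "a / (1 + log 2 (max 1 (1 / a))) * (real n * log 2 (real (m + n))) \<le> real n' * log 2 (real (m + n'))"
    by (simp add: e_def[symmetric] field_simps)
  have "log 2 (real (m + n')) \<le> (1 + log 2 (max 1 b)) * log 2 (real (m + n))"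
    using assms by (intro log_add_le_mult_log) auto
  then have "real n' * log 2 (real (m + n')) \<le> (b * real n) * ((1 + log 2 (max 1 b)) * log 2 (real (m + n)))"
    using assms by (intro mult_mono) auto
  then show "real n' * log 2 (real (m + n')) \<le> b * (1 + log 2 (max 1 b)) * (real n * log 2 (real (m + n)))"
    by (simp add: algebra_simps)
qed

lemma critical_frequency_iff:
  assumes "h < real d"
  shows "critical_frequency h \<rho> l d f \<longleftrightarrow> f > 0 \<and> f = (\<rho> * real l + real d) / (real d - h)"
  using assms by (auto simp: critical_frequency_def cost_cache_def cost_derive_def field_simps)

text \<open>The equation is linear in 1 / f. The bound on \<open>h\<close> keeps the denominator d -
  h between d / 2 and 2 d, and \<open>1 \<le> \<rho> * L\<close> lets the summand d of the numerator
  count as d \<rho> L, so that the constants are free of \<open>\<rho>\<close>.\<close>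

lemma critical_frequency_bounds:
  assumes \<rho>: "0 < \<rho>" and l: "k1 * (real d * L) \<le> real l" "real l \<le> k2 * (real d * L)" and k: "0 < k1" "0 < k2"
    and h: "2 * \<bar>h\<bar> \<le> real d" "0 < d" and L: "1 \<le> \<rho> * L"
  shows "\<exists>!f. critical_frequency h \<rho> l d f"
    and "critical_frequency h \<rho> l d f \<Longrightarrow> k1 / 2 * (\<rho> * L) \<le> f \<and> f \<le> (2 * k2 + 2) * (\<rho> * L)"
proof -
  have dh: "real d / 2 \<le> real d - h" "real d - h \<le> 2 * real d" and pos: "0 < real d - h"
    using h by auto
  let ?f = "(\<rho> * real l + real d) / (real d - h)"
  have "0 < ?f" using pos \<rho> h(2) by (simp add: add_nonneg_pos)
  then show "\<exists>!f. critical_frequency h \<rho> l d f"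
    using pos by (intro ex1I[of _ ?f]) (simp_all add: critical_frequency_iff)
  have "0 < L" using L \<rho> by (metis less_le_trans zero_less_mult_pos zero_less_one)
  have "k1 / 2 * (\<rho> * L) * (real d - h) \<le> k1 / 2 * (\<rho> * L) * (2 * real d)"
    using dh k \<rho> \<open>0 < L\<close> by (intro mult_left_mono) auto
  also have "\<dots> = \<rho> * (k1 * (real d * L))" by simp
  also have "\<dots> \<le> \<rho> * real l" using \<rho> l by (intro mult_left_mono) auto
  also have "\<dots> \<le> \<rho> * real l + real d" by simp
  finally have lower: "k1 / 2 * (\<rho> * L) \<le> ?f" using pos by (simp add: field_simps)
  have "\<rho> * real l \<le> \<rho> * (k2 * (real d * L))" using \<rho> l by (intro mult_left_mono) auto
  moreover have "real d * 1 \<le> real d * (\<rho> * L)" using L by (intro mult_left_mono) auto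
  ultimately have "\<rho> * real l + real d \<le> (2 * k2 + 2) * (\<rho> * L) * (real d / 2)"
    by (simp add: algebra_simps)
  also have "\<dots> \<le> (2 * k2 + 2) * (\<rho> * L) * (real d - h)"
    using dh k \<rho> \<open>0 < L\<close> by (intro mult_left_mono) auto
  finally have upper: "?f \<le> (2 * k2 + 2) * (\<rho> * L)" using pos by (simp add: field_simps)
  show "critical_frequency h \<rho> l d f \<Longrightarrow> k1 / 2 * (\<rho> * L) \<le> f \<and> f \<le> (2 * k2 + 2) * (\<rho> * L)"
    using pos lower upper by (simp add: critical_frequency_iff)
qed

lemma bigtheta_add_smallo:
  fixes X g h :: "'a \<Rightarrow> real"
  assumes "X \<in> \<Theta>[F](g)" "h \<in> o[F](g)"
  shows "(\<lambda>x. X x + h x) \<in> \<Theta>[F](g)"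
proof -
  have "h \<in> o[F](X)"
    using assms(2) landau_o.small.cong_bigtheta[OF assms(1)] by simp
  then have "(\<lambda>x. X x + h x) \<in> \<Theta>[F](X)"
    using bigtheta_refl[of "\<lambda>x. X x + h x" F] by (simp only: landau_theta.plus_absorb2)
  then show ?thesis using assms(1) by (rule landau_theta.trans)
qed

text \<open>The cache cost is A / f + h with A of order d \<rho> L. Adding a term of lower order
  than d does not affect being of order d, and dividing A by A / f isolates \<open>f\<close>. With
  \<open>\<rho>\<close> fixed, the constants may depend on it.\<close>

lemma bigtheta_cost_cache_iff:
  fixes l d :: "'i \<Rightarrow> nat" and h f L :: "'i \<Rightarrow> real"
  assumes \<rho>: "0 < \<rho>" and l: "\<And>i. k1 * (real (d i) * L i) \<le> real (l i)" "\<And>i. real (l i) \<le> k2 * (real (d i) * L i)"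
    and k: "0 < k1" "0 < k2" and h: "h \<in> o[F](\<lambda>i. real (d i))" and L: "\<And>i. 1 \<le> L i"
    and d: "\<And>i. 0 < d i" and f: "\<forall>\<^sub>F i in F. f i > 0"
  shows "(\<lambda>i. cost_cache (h i) \<rho> (f i) (l i) (d i)) \<in> \<Theta>[F](\<lambda>i. cost_derive (d i))
     \<longleftrightarrow> f \<in> \<Theta>[F](\<lambda>i. \<rho> * L i)"
proof -
  define A where "A i = \<rho> * real (l i) + real (d i)" for i
  have A: "A \<in> \<Theta>[F](\<lambda>i. real (d i) * (\<rho> * L i))"
  proof (rule bigthetaI'[of k1 "k2 + 1 / \<rho>"])
    have "k1 * norm (real (d i) * (\<rho> * L i)) \<le> norm (A i) \<and>
        norm (A i) \<le> (k2 + 1 / \<rho>) * norm (real (d i) * (\<rho> * L i))" for i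
    proof -
      have "0 \<le> L i" using L[of i] by simp
      then have norms: "norm (A i) = A i" "norm (real (d i) * (\<rho> * L i)) = real (d i) * (\<rho> * L i)"
        using \<rho> by (simp_all add: A_def abs_mult)
      have "\<rho> * (k1 * (real (d i) * L i)) \<le> \<rho> * real (l i)"
        "\<rho> * real (l i) \<le> \<rho> * (k2 * (real (d i) * L i))"
        using \<rho> l by (auto intro: mult_left_mono)
      moreover have "real (d i) * 1 \<le> real (d i) * L i" using L by (intro mult_left_mono) auto
      moreover have "k1 * (real (d i) * (\<rho> * L i)) = \<rho> * (k1 * (real (d i) * L i))"
        by simp
      moreover have "(k2 + 1 / \<rho>) * (real (d i) * (\<rho> * L i)) = \<rho> * (k2 * (real (d i) * L i)) + real (d i) * L i"
        using \<rho> by (simp add: field_simps)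
      ultimately show ?thesis
        unfolding norms unfolding A_def by (intro conjI; linarith)
    qed
    then show "\<forall>\<^sub>F i in F. k1 * norm (real (d i) * (\<rho> * L i)) \<le> norm (A i) \<and>
        norm (A i) \<le> (k2 + 1 / \<rho>) * norm (real (d i) * (\<rho> * L i))"
      by (rule always_eventually[OF allI])
  qed (use k \<rho> in \<open>auto simp: add_pos_pos\<close>)
  have nz: "A i > 0" "L i > 0" for i
    using \<rho> d[of i] L[of i] by (auto simp: A_def add_nonneg_pos)
  have f': "\<forall>\<^sub>F i in F. f i \<noteq> 0" using f by (rule eventually_mono) auto
  then have quot: "\<forall>\<^sub>F i in F. A i / f i \<noteq> 0"
    by (rule eventually_mono) (use nz(1) in \<open>simp add: less_imp_neq[symmetric]\<close>)
  have cost: "cost_cache (h i) \<rho> (f i) (l i) (d i) = A i / f i + h i" for i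
    by (simp add: cost_cache_def A_def add_divide_distrib)
  have h': "(\<lambda>i. - h i) \<in> o[F](\<lambda>i. real (d i))" using h by simp
  have "(\<lambda>i. A i / f i + h i) \<in> \<Theta>[F](\<lambda>i. real (d i)) \<longleftrightarrow> (\<lambda>i. A i / f i) \<in> \<Theta>[F](\<lambda>i. real (d i))"
    using bigtheta_add_smallo[OF _ h, of "\<lambda>i. A i / f i"] bigtheta_add_smallo[OF _ h', of "\<lambda>i. A i / f i + h i"]
    by auto
  also have "\<dots> \<longleftrightarrow> f \<in> \<Theta>[F](\<lambda>i. \<rho> * L i)"
  proof
    assume "(\<lambda>i. A i / f i) \<in> \<Theta>[F](\<lambda>i. real (d i))"
    then have "(\<lambda>i. real (d i)) \<in> \<Theta>[F](\<lambda>i. A i / f i)" by (simp only: bigtheta_sym)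
    from landau_theta.divide[OF quot _ A this]
    have "(\<lambda>i. A i / (A i / f i)) \<in> \<Theta>[F](\<lambda>i. real (d i) * (\<rho> * L i) / real (d i))"
      using d by simp
    moreover have "A i / (A i / f i) = f i" "real (d i) * (\<rho> * L i) / real (d i) = \<rho> * L i" for i
      using nz(1)[of i] d[of i] by auto
    ultimately show "f \<in> \<Theta>[F](\<lambda>i. \<rho> * L i)" by simp
  next
    assume "f \<in> \<Theta>[F](\<lambda>i. \<rho> * L i)"
    then have "(\<lambda>i. \<rho> * L i) \<in> \<Theta>[F](f)" by (simp only: bigtheta_sym)
    from landau_theta.divide[OF f' _ A this]
    have "(\<lambda>i. A i / f i) \<in> \<Theta>[F](\<lambda>i. real (d i) * (\<rho> * L i) / (\<rho> * L i))"
      using nz(2) \<rho> by (simp add: less_imp_neq[symmetric])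
    moreover have "real (d i) * (\<rho> * L i) / (\<rho> * L i) = real (d i)" for i
      using nz(2)[of i] \<rho> by simp
    ultimately show "(\<lambda>i. A i / f i) \<in> \<Theta>[F](\<lambda>i. real (d i))" by simp
  qed
  finally show ?thesis by (simp add: cost cost_derive_def)
qed

text \<open>Each strategy is compared with itself; by \<open>f \<ge> 1\<close> the depth excess k /
  f of the cache strategy is at most \<open>k\<close>.\<close>

lemma cost_opt_le:
  assumes "0 < \<rho>" "1 \<le> f" "real l' \<le> real l + x" "d' \<le> d + k" "0 \<le> x"
  shows "cost_opt h \<rho> f l' d' \<le> cost_opt h \<rho> f l d + \<rho> * x / f + real k"
proof -
  have "\<rho> * real l' \<le> \<rho> * real l + \<rho> * x"
    using mult_left_mono[OF assms(3), of \<rho>] assms(1) by (simp add: algebra_simps)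
  then have l: "\<rho> * real l' / f \<le> \<rho> * real l / f + \<rho> * x / f"
    using assms(2) by (simp add: divide_right_mono flip: add_divide_distrib)
  have "real d' / f \<le> (real d + real k) / f"
    using assms(2,4) by (intro divide_right_mono) auto
  also have "\<dots> \<le> real d / f + real k"
    using assms(2) by (simp add: add_divide_distrib divide_le_eq mult_le_cancel_left1)
  finally have d: "real d' / f \<le> real d / f + real k" .
  have "0 \<le> \<rho> * x / f" using assms by simp
  with l d assms(4) show ?thesis
    unfolding cost_opt_def cost_cache_def cost_derive_def by linarith
qed

theorem propositionV2:
  fixes \<P> :: calculus
    and S :: "fml set"
    and PO :: "fml \<Rightarrow> fml set"
    and U :: "bool list \<Rightarrow> nat \<Rightarrow> nat option"
    and pb :: "nat poly"
    and \<l> :: "fml \<Rightarrow> fml set \<Rightarrow> nat"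
    and \<C> :: "(fml \<times> fml set) set"
    and \<delta>\<^sub>0 \<delta> :: real
    and q :: "'i \<Rightarrow> fml"
    and B0 Bm Bp Bt :: "'i \<Rightarrow> fml set"
    and m N mt nt n' lt :: "'i \<Rightarrow> nat"
    and c_hit :: "'i \<Rightarrow> real"
    and F :: "'i filter"
  assumes effective: "effective_calculus \<P>"
    and premise_struct: "premise_structure \<P> S PO"
    and universal: "universal_prefix_machine U"
    and lengths: "code_length U \<P> S \<l>"
    \<comment> \<open>the family of instances\<close>
    and base: "\<And>i. premise_base S (B0 i)" "\<And>i. B0 i \<noteq> {}"
    and noisy: "\<And>i. Bm i \<subseteq> B0 i" "\<And>i. finite (Bp i)" "\<And>i. Bp i \<subseteq> S - B0 i"
    and Bt: "\<And>i. Bt i = noisy_base (B0 i) (Bm i) (Bp i)" "\<And>i. Bt i \<noteq> {}"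
    and normal_form: "\<And>i. normal_form_premises \<P> S PO (B0 i)"
        "\<And>i. normal_form_premises \<P> S PO (Bt i)"
        "\<And>i. normal_form_premises \<P> S PO (B0 i - Bm i)"
    and query: "\<And>i. q i \<in> S" "\<And>i. q i \<in> Cn \<P> (Bt i) \<inter> Cn \<P> (B0 i)"
    and m: "\<And>i. m i = card (B0 i)"
    and N: "\<And>i. N i = card (Bm i) + card (Bp i)"
    and mt: "\<And>i. mt i = card (Bt i)"
    and nt: "\<And>i. nt i = Dd S PO (Bt i) (q i)"
    and n': "\<And>i. enat (n' i) = Ntr \<P> (Bt i) (q i)"
    and lt: "\<And>i. lt i = \<l> (q i) (Bt i)"
    and F: "F = filtercomap mt at_top"
    and c_hit: "\<exists>h. \<forall>i. \<bar>c_hit i\<bar> \<le> h"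
    \<comment> \<open>hypotheses of the depth-information theorem\<close>
    and information_rich:
        "(\<lambda>i. real (Kolm U (code \<P> (q i)) (base_code \<P> (Bt i)))) \<in> \<omega>[F](\<lambda>i. log 2 (real (mt i)))"
    and depth: "\<And>i. 1 \<le> nt i" "\<And>i. log 2 (real (mt i)) \<le> real (nt i)" "\<And>i. nt i \<le> poly pb (mt i)"
    and serial: "serializable \<P> S PO \<C>" "\<And>i. (q i, Bt i) \<in> \<C>"
    and richness: "rich \<P> S pb \<delta>\<^sub>0"
    and deltas: "0 < \<delta>\<^sub>0" "\<delta>\<^sub>0 < \<delta>" "\<delta> < 1"
    and generic: "\<And>i. (1 - \<delta>) * real (n' i) * log 2 (real (mt i + n' i))
                        \<le> real (Kolm U (code \<P> (q i)) (base_code \<P> (Bt i)))"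
  shows "
    \<comment> \<open>(i)\<close>
    (\<exists>C>0. \<exists>c1>0. \<exists>c2>0. \<forall>i. \<forall>\<rho>>0. \<forall>f\<ge>1. \<exists>a b t.
       \<bar>a\<bar> \<le> C * (real (nt i) / f) \<and> \<bar>b\<bar> \<le> C \<and>
       c1 * (real (lt i) / log 2 (real (mt i + nt i))) \<le> t \<and>
       t \<le> c2 * (real (lt i) / log 2 (real (mt i + nt i))) \<and>
       cost_cache (c_hit i) \<rho> f (lt i) (nt i) = \<rho> * real (lt i) / f + a + b \<and>
       cost_derive (nt i) = t \<and>
       cost_opt (c_hit i) \<rho> f (lt i) (nt i) = min (\<rho> * real (lt i) / f + a + b) t) \<and>
    \<comment> \<open>(ii), exact equality of the two costs\<close>
    (\<exists>c1>0. \<exists>c2>0. \<forall>\<rho>>0. \<forall>\<^sub>F i in F.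
       (\<exists>!f. critical_frequency (c_hit i) \<rho> (lt i) (nt i) f) \<and>
       (\<forall>f. critical_frequency (c_hit i) \<rho> (lt i) (nt i) f \<longrightarrow>
          c1 * (\<rho> * log 2 (real (mt i + nt i))) \<le> f \<and>
          f \<le> c2 * (\<rho> * log 2 (real (mt i + nt i))))) \<and>
    \<comment> \<open>(ii), equality of the two costs up to constant factors\<close>
    (\<forall>\<rho>>0. \<forall>f. (\<forall>\<^sub>F i in F. f i > 0) \<longrightarrow>
       ((\<lambda>i. cost_cache (c_hit i) \<rho> (f i) (lt i) (nt i)) \<in> \<Theta>[F](\<lambda>i. cost_derive (nt i))
        \<longleftrightarrow> f \<in> \<Theta>[F](\<lambda>i. \<rho> * log 2 (real (mt i + nt i))))) \<and>
    \<comment> \<open>(iii)\<close>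
    (describable_noise \<P> S pb B0 Bm Bp \<longrightarrow>
       (\<exists>C>0. \<forall>i. \<forall>\<rho>>0. \<forall>f\<ge>1.
          ereal (cost_opt (c_hit i) \<rho> f (lt i) (nt i))
            \<le> ereal (cost_opt (c_hit i) \<rho> f (\<l> (q i) (B0 i)) (Dd S PO (B0 i) (q i))
                      + C * (\<rho> * real (N i) * log 2 (real (m i + N i)) / f))
              + ereal C * ereal_of_enat (rec_depth \<P> S PO (B0 i) (Bm i))))"
proof -
  define L where "L i = log 2 (real (mt i + nt i))" for i
  have S: "S \<subseteq> lang \<P>" using premise_struct by (simp add: premise_structure_def)
  have Bt_base: "premise_base S (Bt i)" for i
    using base(1)[of i] noisy(2,3)[of i] unfolding Bt premise_base_def noisy_base_def by auto
  then have Bt_fin: "finite (Bt i)" "Bt i \<subseteq> lang \<P>" for i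
    using S unfolding premise_base_def by auto
  have mt1: "1 \<le> mt i" for i
    using Bt_fin(1)[of i] Bt(2)[of i] by (simp add: mt Suc_le_eq card_gt_0_iff)
  have L1: "1 \<le> L i" for i
    using mt1[of i] depth(1)[of i] by (simp add: L_def)
  obtain c where c: "\<And>q B. q \<in> S \<Longrightarrow> premise_base S B \<Longrightarrow>
      Kolm U (code \<P> q) (base_code \<P> B) \<le> \<l> q B \<and> \<l> q B \<le> Kolm U (code \<P> q) (base_code \<P> B) + c"
    using lengths unfolding code_length_def by meson
  obtain H where H: "\<And>i. \<bar>c_hit i\<bar> \<le> H" using c_hit by blast

  \<comment> \<open>The lower constant comes from genericity, positive because
    \<open>\<delta> < 1\<close>; the upper one comes from the trace program together with the slack
    \<open>c\<close> of the code length.\<close>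
  have "\<exists>k1>0. \<exists>k2>0. \<forall>i. k1 * (real (nt i) * L i) \<le> real (lt i) \<and> real (lt i) \<le> k2 * (real (nt i) * L i)"
  proof -
    obtain cmin cmax where cpos: "0 < cmin" "0 < cmax"
      and ser: "\<forall>(q, B)\<in>\<C>. q \<in> Cn \<P> B \<longrightarrow>
        ereal (cmin * real (Dd S PO B q)) \<le> ereal_of_enat (Ntr \<P> B q) \<and>
        ereal_of_enat (Ntr \<P> B q) \<le> ereal (cmax * real (Dd S PO B q))"
      using serial(1) unfolding serializable_def by auto
    have n: "cmin * real (nt i) \<le> real (n' i)" "real (n' i) \<le> cmax * real (nt i)" for i
      using bspec[OF ser serial(2)[of i]] query(2)[of i] n'[of i, symmetric] by (simp_all add: nt)
    have n1: "1 \<le> n' i" for i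
    proof -
      have "0 < cmin * real (nt i)" using cpos depth(1)[of i] by simp
      with n(1)[of i] show ?thesis by (cases "n' i") auto
    qed
    define T where "T i = real (n' i) * log 2 (real (mt i + n' i))" for i
    define a where "a = cmin / (1 + log 2 (max 1 (1 / cmin)))"
    define b where "b = cmax * (1 + log 2 (max 1 cmax))"
    have ab: "0 < a" "0 < b"
      using cpos by (auto simp: a_def b_def intro!: divide_pos_pos mult_pos_pos add_pos_nonneg)
    have T: "a * (real (nt i) * L i) \<le> T i" "T i \<le> b * (real (nt i) * L i)" for i
      using Theta_depth_le[OF mt1 depth(1) cpos(1) n] by (auto simp: a_def b_def L_def T_def)
    obtain K where K: "0 < K" and Kle: "\<And>B q n. finite B \<Longrightarrow> B \<subseteq> lang \<P> \<Longrightarrow> B \<noteq> {} \<Longrightarrow> 1 \<le> n \<Longrightarrow>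
        Ntr \<P> B q = enat n \<Longrightarrow> real (Kolm U (code \<P> q) (base_code \<P> B)) \<le> K * real n * log 2 (real (card B + n))"
      using Kolm_le_Ntr[OF effective universal] by blast
    have lower: "(1 - \<delta>) * a * (real (nt i) * L i) \<le> real (lt i)" for i
    proof -
      have "(1 - \<delta>) * (a * (real (nt i) * L i)) \<le> (1 - \<delta>) * T i"
        using T(1) deltas by (intro mult_left_mono) auto
      also have "\<dots> \<le> real (Kolm U (code \<P> (q i)) (base_code \<P> (Bt i)))"
        using generic[of i] by (simp add: T_def mult.assoc)
      also have "\<dots> \<le> real (lt i)"
        using c[OF query(1) Bt_base] by (simp add: lt)
      finally show ?thesis by (simp add: mult.assoc)
    qed
    have upper: "real (lt i) \<le> (K * b + real c) * (real (nt i) * L i)" for i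
    proof -
      have "real (lt i) \<le> real (Kolm U (code \<P> (q i)) (base_code \<P> (Bt i))) + real c"
        using c[OF query(1)[of i] Bt_base[of i]] by (simp add: lt)
      also have "\<dots> \<le> K * T i + real c"
        using Kle[OF Bt_fin Bt(2) n1 n'[symmetric], of i] by (simp add: T_def mt mult.assoc)
      also have "\<dots> \<le> K * (b * (real (nt i) * L i)) + real c * (real (nt i) * L i)"
      proof (intro add_mono)
        show "K * T i \<le> K * (b * (real (nt i) * L i))"
          using T(2) K by (intro mult_left_mono) auto
        have "1 \<le> real (nt i) * L i" using depth(1)[of i] L1[of i] by (intro mult_ge1_I) auto
        then show "real c \<le> real c * (real (nt i) * L i)" by (simp add: mult_le_cancel_left1)
      qed
      finally show ?thesis by (simp add: algebra_simps)
    qed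
    show ?thesis
      using lower upper ab K deltas
      by (intro exI[of _ "(1 - \<delta>) * a"] exI[of _ "K * b + real c"] conjI allI) (auto intro: add_pos_nonneg)
  qed
  then obtain k1 k2 where k: "0 < k1" "0 < k2"
    and l: "\<And>i. k1 * (real (nt i) * L i) \<le> real (lt i)" "\<And>i. real (lt i) \<le> k2 * (real (nt i) * L i)"
    by blast

  \<comment> \<open>\<open>F\<close> is pulled back along \<open>mt\<close>, so log mt is eventually
    large, and with it the depth and \<open>L\<close>, which are both at least log mt.\<close>
  have ev_mt: "\<forall>\<^sub>F i in F. x \<le> log 2 (real (mt i))" for x
  proof -
    have "\<forall>\<^sub>F k in at_top. x \<le> log 2 (real k)"
    proof (rule eventually_at_top_linorderI)
      fix k :: nat
      assume "nat \<lceil>2 powr x\<rceil> \<le> k"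
      then have "2 powr x \<le> real k" by linarith
      moreover from this have "0 < real k" using powr_gt_zero[of 2 x] by linarith
      ultimately show "x \<le> log 2 (real k)" by (simp add: le_log_iff)
    qed
    then show ?thesis unfolding F by (rule eventually_compose_filterlim[OF _ filterlim_filtercomap])
  qed
  have ev_nt: "\<forall>\<^sub>F i in F. x \<le> real (nt i)" for x
    using ev_mt[of x] by (rule eventually_mono) (rule order_trans[OF _ depth(2)])
  have ev_L: "\<forall>\<^sub>F i in F. x \<le> L i" for x
    using ev_mt[of x]
  proof (rule eventually_mono)
    fix i
    have "log 2 (real (mt i)) \<le> L i"
      using mt1[of i] by (simp add: L_def)
    then show "x \<le> log 2 (real (mt i)) \<Longrightarrow> x \<le> L i" by linarith
  qed

  have i: "\<exists>C>0. \<exists>c1>0. \<exists>c2>0. \<forall>i. \<forall>\<rho>>0. \<forall>f\<ge>1. \<exists>a b t.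
       \<bar>a\<bar> \<le> C * (real (nt i) / f) \<and> \<bar>b\<bar> \<le> C \<and>
       c1 * (real (lt i) / log 2 (real (mt i + nt i))) \<le> t \<and>
       t \<le> c2 * (real (lt i) / log 2 (real (mt i + nt i))) \<and>
       cost_cache (c_hit i) \<rho> f (lt i) (nt i) = \<rho> * real (lt i) / f + a + b \<and>
       cost_derive (nt i) = t \<and>
       cost_opt (c_hit i) \<rho> f (lt i) (nt i) = min (\<rho> * real (lt i) / f + a + b) t"
  proof (intro exI conjI allI impI)
    \<comment> \<open>The witnesses are n / f for \<open>a\<close>, the hit overhead for
      \<open>b\<close> and the depth for \<open>t\<close>; 1 / k2 and 1 / k1 invert the two bounds
      on the code length.\<close>
    show "0 < max 1 H" "0 < 1 / k2" "0 < 1 / k1" using k by auto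
    fix i and \<rho> f :: real
    assume "0 < \<rho>" "1 \<le> f"
    have "\<bar>real (nt i) / f\<bar> = 1 * (real (nt i) / f)" using \<open>1 \<le> f\<close> by simp
    also have "\<dots> \<le> max 1 H * (real (nt i) / f)"
      using \<open>1 \<le> f\<close> by (intro mult_right_mono) auto
    finally show "\<bar>real (nt i) / f\<bar> \<le> max 1 H * (real (nt i) / f)" .
    show "\<bar>c_hit i\<bar> \<le> max 1 H" using H[of i] by simp
    show "1 / k2 * (real (lt i) / log 2 (real (mt i + nt i))) \<le> real (nt i)"
      "real (nt i) \<le> 1 / k1 * (real (lt i) / log 2 (real (mt i + nt i)))"
      using l[of i] k L1[of i] unfolding L_def[symmetric] by (simp_all add: field_simps)
  qed (simp_all add: cost_cache_def cost_derive_def cost_opt_def)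

  have ii: "\<exists>c1>0. \<exists>c2>0. \<forall>\<rho>>0. \<forall>\<^sub>F i in F.
       (\<exists>!f. critical_frequency (c_hit i) \<rho> (lt i) (nt i) f) \<and>
       (\<forall>f. critical_frequency (c_hit i) \<rho> (lt i) (nt i) f \<longrightarrow>
          c1 * (\<rho> * log 2 (real (mt i + nt i))) \<le> f \<and>
          f \<le> c2 * (\<rho> * log 2 (real (mt i + nt i))))"
  proof (intro exI conjI allI impI)
    show "0 < k1 / 2" "0 < 2 * k2 + 2" using k by auto
    fix \<rho> :: real
    assume \<rho>: "0 < \<rho>"
    show "\<forall>\<^sub>F i in F.
       (\<exists>!f. critical_frequency (c_hit i) \<rho> (lt i) (nt i) f) \<and>
       (\<forall>f. critical_frequency (c_hit i) \<rho> (lt i) (nt i) f \<longrightarrow>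
          k1 / 2 * (\<rho> * log 2 (real (mt i + nt i))) \<le> f \<and>
          f \<le> (2 * k2 + 2) * (\<rho> * log 2 (real (mt i + nt i))))"
      \<comment> \<open>How far along \<open>F\<close> one must go depends on \<open>\<rho>\<close>,
        through 1 \<le> \<rho> L; the constants do not.\<close>
      using ev_nt[of "2 * H"] ev_L[of "1 / \<rho>"]
    proof eventually_elim
      case (elim i)
      have "2 * \<bar>c_hit i\<bar> \<le> real (nt i)" "0 < nt i" "1 \<le> \<rho> * L i"
        using H[of i] elim depth(1)[of i] \<rho> by (auto simp: field_simps)
      from critical_frequency_bounds[OF \<rho> l k this] show ?case
        unfolding L_def by blast
    qed
  qed

  have iii: "\<forall>\<rho>>0. \<forall>f. (\<forall>\<^sub>F i in F. f i > 0) \<longrightarrow>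
       ((\<lambda>i. cost_cache (c_hit i) \<rho> (f i) (lt i) (nt i)) \<in> \<Theta>[F](\<lambda>i. cost_derive (nt i))
        \<longleftrightarrow> f \<in> \<Theta>[F](\<lambda>i. \<rho> * log 2 (real (mt i + nt i))))"
  proof (intro allI impI)
    fix \<rho> :: real and f :: "'i \<Rightarrow> real"
    assume \<rho>: "0 < \<rho>" and f: "\<forall>\<^sub>F i in F. f i > 0"
    have h: "c_hit \<in> o[F](\<lambda>i. real (nt i))"
    proof (rule landau_o.smallI)
      fix e :: real
      assume e: "0 < e"
      show "\<forall>\<^sub>F i in F. norm (c_hit i) \<le> e * norm (real (nt i))"
        using ev_nt[of "H / e"]
      proof (rule eventually_mono)
        fix i assume "H / e \<le> real (nt i)"
        then have "H \<le> e * real (nt i)" using e by (simp add: field_simps)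
        with H[of i] show "norm (c_hit i) \<le> e * norm (real (nt i))" by simp
      qed
    qed
    have "0 < nt i" for i using depth(1)[of i] by simp
    from bigtheta_cost_cache_iff[OF \<rho> l k h L1 this f]
    show "((\<lambda>i. cost_cache (c_hit i) \<rho> (f i) (lt i) (nt i)) \<in> \<Theta>[F](\<lambda>i. cost_derive (nt i))
        \<longleftrightarrow> f \<in> \<Theta>[F](\<lambda>i. \<rho> * log 2 (real (mt i + nt i))))"
      unfolding L_def .
  qed

  have iv: "\<exists>C>0. \<forall>i. \<forall>\<rho>>0. \<forall>f\<ge>1.
          ereal (cost_opt (c_hit i) \<rho> f (lt i) (nt i))
            \<le> ereal (cost_opt (c_hit i) \<rho> f (\<l> (q i) (B0 i)) (Dd S PO (B0 i) (q i))
                      + C * (\<rho> * real (N i) * log 2 (real (m i + N i)) / f))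
              + ereal C * ereal_of_enat (rec_depth \<P> S PO (B0 i) (Bm i))"
    if descr: "describable_noise \<P> S pb B0 Bm Bp"
  proof -
    obtain K where K: "0 < K" and Kle: "\<And>i x. 1 \<le> card (Bm i) + card (Bp i) \<Longrightarrow>
     real (Kolm U x (base_code \<P> (noisy_base (B0 i) (Bm i) (Bp i))))
       \<le> real (Kolm U x (base_code \<P> (B0 i)))
        + K * real (card (Bm i) + card (Bp i)) * log 2 (real (card (B0 i) + (card (Bm i) + card (Bp i))))"
      using Kolm_noisy_base_le[OF effective S universal base noisy descr] by blast
    \<comment> \<open>\<open>K + c\<close> prices the noise description and the slack of the code
      length; the maximum with 1 lets the same constant multiply the reconstruction depth.\<close>
    define C where "C = max 1 (K + real c)"
    have lt_le: "real (lt i) \<le> real (\<l> (q i) (B0 i)) + C * (real (N i) * log 2 (real (m i + N i)))"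
      and nonneg: "0 \<le> real (N i) * log 2 (real (m i + N i))" for i
    proof -
      have fin: "finite (Bm i)" "finite (B0 i)"
        using base(1)[of i] noisy(1)[of i] by (auto simp: premise_base_def intro: finite_subset)
      have m1: "1 \<le> m i" using base(2)[of i] fin(2) by (simp add: m Suc_le_eq card_gt_0_iff)
      show nonneg: "0 \<le> real (N i) * log 2 (real (m i + N i))"
        using m1 by (intro mult_nonneg_nonneg) auto
      show "real (lt i) \<le> real (\<l> (q i) (B0 i)) + C * (real (N i) * log 2 (real (m i + N i)))"
      \<comment> \<open>Without noise the error term vanishes and could not absorb the slack
        \<open>c\<close>, but then the two bases coincide and so do the code lengths.\<close>
      proof (cases "N i = 0")
        case True
        then have "Bt i = B0 i"
          using fin(1) noisy(2)[of i] by (simp add: N Bt(1) noisy_base_def)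
        then show ?thesis by (simp add: lt True)
      next
        case False
        let ?X = "real (N i) * log 2 (real (m i + N i))"
        have "1 \<le> ?X" using False m1 by (intro mult_ge1_I) auto
        have "real (lt i) \<le> real (Kolm U (code \<P> (q i)) (base_code \<P> (Bt i))) + real c"
          using c[OF query(1)[of i] Bt_base[of i]] by (simp add: lt)
        also have "real (Kolm U (code \<P> (q i)) (base_code \<P> (Bt i)))
            \<le> real (Kolm U (code \<P> (q i)) (base_code \<P> (B0 i))) + K * ?X"
          using Kle[of i "code \<P> (q i)"] False by (simp add: N m Bt(1) mult.assoc Suc_le_eq)
        also have "real (Kolm U (code \<P> (q i)) (base_code \<P> (B0 i))) \<le> real (\<l> (q i) (B0 i))"
          using c[OF query(1)[of i] base(1)[of i]] by simp
        also have "real c \<le> real c * ?X" using \<open>1 \<le> ?X\<close> by (simp add: mult_le_cancel_left1)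
        finally have "real (lt i) \<le> real (\<l> (q i) (B0 i)) + (K + real c) * ?X"
          by (simp add: algebra_simps)
        also have "(K + real c) * ?X \<le> C * ?X"
          using nonneg by (intro mult_right_mono) (auto simp: C_def)
        finally show ?thesis by simp
      qed
    qed
    show ?thesis
    proof (intro exI[of _ C] conjI allI impI)
      show "0 < C" by (simp add: C_def)
      fix i and \<rho> f :: real
      assume \<rho>: "0 < \<rho>" and f: "1 \<le> f"
      show "ereal (cost_opt (c_hit i) \<rho> f (lt i) (nt i))
            \<le> ereal (cost_opt (c_hit i) \<rho> f (\<l> (q i) (B0 i)) (Dd S PO (B0 i) (q i))
                      + C * (\<rho> * real (N i) * log 2 (real (m i + N i)) / f))
              + ereal C * ereal_of_enat (rec_depth \<P> S PO (B0 i) (Bm i))"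
      proof (cases "rec_depth \<P> S PO (B0 i) (Bm i)")
        case (enat d)
        have "nt i \<le> Dd S PO (B0 i) (q i) + d"
          using Dd_noisy_le[OF premise_struct _ noisy(1) query(1) enat] base(1)[of i]
          by (simp add: nt Bt(1) premise_base_def)
        from cost_opt_le[OF \<rho> f lt_le this]
        have "cost_opt (c_hit i) \<rho> f (lt i) (nt i) \<le> cost_opt (c_hit i) \<rho> f (\<l> (q i) (B0 i)) (Dd S PO (B0 i) (q i))
             + \<rho> * (C * (real (N i) * log 2 (real (m i + N i)))) / f + real d"
          using nonneg[of i] by (simp add: C_def)
        also have "real d \<le> C * real d" by (simp add: C_def mult_le_cancel_right1)
        finally show ?thesis by (simp add: enat mult_ac)
      next
        \<comment> \<open>An unrecoverable premise makes the right-hand side infinite, because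
          \<open>C\<close> is positive.\<close>
        case infinity
        have "0 < C" by (simp add: C_def)
        then show ?thesis by (simp add: infinity)
      qed
    qed
  qed
  show ?thesis
    using i ii iii iv by blast
qed

end
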